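(* Let $L>0$, let $n\ge 1$ be an integer, let $a\in\Lambda_n$ be given and let $u$ be any nontrivial solution of $$u''(x)+a(x)u(x)=0,\ x\in(0,L),\qquad u'(0)=u'(L)=0.$$ Denote the zeros of $u'$ in $[0,L]$ by $0=x_0<x_2<\dots<x_{2m}=L$ and the zeros of $u$ in $(0,L)$ by $x_1<x_3<\dots<x_{2m-1}$ (these zeros interlace: $0=x_0<x_1<x_2<\dots<x_{2m-1}<x_{2m}=L$). Then: (1) $x_{i+1}-x_i\le \frac{L}{2n}$ for all $i$ with $0\le i\le 2m-1$. Moreover, at least one of these inequalities is strict. (2) $m\ge n+1$. Moreover, any value $m\ge n+1$ is possible, i.e. for every integer $m\ge n+1$ there exist $a\in\Lambda_n$ and a nontrivial solution $u$ of the corresponding problem for which the number of zeros of $u$ in $(0,L)$ is $m$. (3) For every $i$ with $0\le i\le 2m-1$, $$\|a-\lambda_n\|_{L^1(x_i,x_{i+1})}\ \ge\ \frac{\int_{x_i}^{x_{i+1}}u'^2-\lambda_n\int_{x_i}^{x_{i+1}}u^2}{u^2(x_{i+1})}\quad\text{if } i \text{ is odd},$$ and $$\|a-\lambda_n\|_{L^1(x_i,x_{i+1})}\ \ge\ \frac{\int_{x_i}^{x_{i+1}}u'^2-\lambda_n\int_{x_i}^{x_{i+1}}u^2}{u^2(x_{i})}\quad\text{if } i \text{ is even}.$$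
   Context: For $c,d\in L^1(0,L)$ write $c\prec d$ if $c(x)\le d(x)$ for a.e. $x\in[0,L]$ and $c(x)<d(x)$ on a set of positive measure. Let $\lambda_n=n^2\pi^2/L^2$, also regarded as a constant function. Solutions $u$ of the Neumann problem $u''+au=0$ on $(0,L)$, $u'(0)=u'(L)=0$ (with $a\in L^1(0,L)$) are real-valued and taken in the Sobolev space $H^1(0,L)$ in the weak sense; nontrivial means not identically zero. Define $$\Lambda_n=\{a\in L^1(0,L):\ \lambda_n\prec a\ \text{and the Neumann problem has nontrivial solutions}\}.$$ *)

theory Defs
  imports "HOL-Analysis.Analysis"
begin

definition eigval :: "real \<Rightarrow> nat \<Rightarrow> real" where
  "eigval L n = (real n)\<^sup>2 * pi\<^sup>2 / L\<^sup>2"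

definition L1_space :: "real \<Rightarrow> (real \<Rightarrow> real) set" where
  "L1_space L = {a. integrable (lebesgue_on {0<..<L}) a}"

definition L2_space :: "real \<Rightarrow> (real \<Rightarrow> real) set" where
  "L2_space L = {f. f \<in> borel_measurable (lebesgue_on {0<..<L})
                   \<and> integrable (lebesgue_on {0<..<L}) (\<lambda>x. (f x)\<^sup>2)}"

definition prec_ae :: "real \<Rightarrow> (real \<Rightarrow> real) \<Rightarrow> (real \<Rightarrow> real) \<Rightarrow> bool" where
  "prec_ae L c d \<longleftrightarrow>
     (AE x in lebesgue_on {0..L}. c x \<le> d x)
     \<and> emeasure lebesgue {x \<in> {0..L}. c x < d x} > 0"

text \<open>The space of smooth functions with compact support in the open interval from 0 to L.\<close>

definition test_function :: "real \<Rightarrow> (real \<Rightarrow> real) \<Rightarrow> bool" where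
  "test_function L \<phi> \<longleftrightarrow>
     (\<forall>k x. (deriv ^^ k) \<phi> differentiable (at x))
     \<and> (\<exists>c d. 0 < c \<and> d < L \<and> (\<forall>x. x \<notin> {c..d} \<longrightarrow> \<phi> x = 0))"

text \<open>The function \<open>u\<close> belongs to the Sobolev space \<open>H\<^sup>1(0,L)\<close> and \<open>g\<close> is (a representative of) its
  weak derivative.  The space \<open>H\<^sup>1(0,L)\<close> itself consists of those \<open>u\<close> for which such a \<open>g\<close> exists.\<close>

definition H1_with_deriv :: "real \<Rightarrow> (real \<Rightarrow> real) \<Rightarrow> (real \<Rightarrow> real) \<Rightarrow> bool" where
  "H1_with_deriv L u g \<longleftrightarrow>
     u \<in> L2_space L \<and> g \<in> L2_space L
     \<and> (\<forall>\<phi>. test_function L \<phi> \<longrightarrow>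
          (LINT x|lebesgue_on {0<..<L}. u x * deriv \<phi> x)
            = - (LINT x|lebesgue_on {0<..<L}. g x * \<phi> x))"

text \<open>Weak solutions of \<open>u'' + a u = 0\<close>, \<open>u'(0) = u'(L) = 0\<close>.  The boundary conditions are the natural
  ones: they are encoded by testing against all of \<open>H\<^sup>1(0,L)\<close>, not only against functions vanishing
  at the end points.  An element of \<open>H\<^sup>1(0,L)\<close> is a class of functions up to null sets; as the
  values of \<open>u\<close> at points matter, \<open>u\<close> stands for the continuous representative on \<open>[0,L]\<close>.\<close>

definition neumann_solution :: "real \<Rightarrow> (real \<Rightarrow> real) \<Rightarrow> (real \<Rightarrow> real) \<Rightarrow> bool" where
  "neumann_solution L a u \<longleftrightarrow>
     continuous_on {0..L} u
     \<and> (\<exists>g. H1_with_deriv L u g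
          \<and> (\<forall>v h. H1_with_deriv L v h \<longrightarrow>
                (LINT x|lebesgue_on {0<..<L}. g x * h x)
                  = (LINT x|lebesgue_on {0<..<L}. a x * u x * v x)))"

definition nontrivial_neumann_solution :: "real \<Rightarrow> (real \<Rightarrow> real) \<Rightarrow> (real \<Rightarrow> real) \<Rightarrow> bool" where
  "nontrivial_neumann_solution L a u \<longleftrightarrow>
     neumann_solution L a u \<and> (\<exists>x\<in>{0..L}. u x \<noteq> 0)"

definition Lambda_set :: "real \<Rightarrow> nat \<Rightarrow> (real \<Rightarrow> real) set" where
  "Lambda_set L n =
     {a \<in> L1_space L. prec_ae L (\<lambda>_. eigval L n) a
                     \<and> (\<exists>u. nontrivial_neumann_solution L a u)}"

text \<open>Zeros of the classical derivative, which is one-sided at the end points of \<open>[0,L]\<close>.\<close>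

definition deriv_zeros :: "real \<Rightarrow> (real \<Rightarrow> real) \<Rightarrow> real set" where
  "deriv_zeros L u = {t \<in> {0..L}. (u has_real_derivative 0) (at t within {0..L})}"

definition inner_zeros :: "real \<Rightarrow> (real \<Rightarrow> real) \<Rightarrow> real set" where
  "inner_zeros L u = {t \<in> {0<..<L}. u t = 0}"

text \<open>The points \<open>x 0 < x 1 < \<dots> < x (2 * m)\<close> list all zeros of \<open>u'\<close> in \<open>[0,L]\<close> (even indices) and
  all zeros of \<open>u\<close> in the open interval (odd indices).  Values of \<open>x\<close> beyond \<open>2 * m\<close> are
  irrelevant.\<close>

definition zeros_enum :: "real \<Rightarrow> (real \<Rightarrow> real) \<Rightarrow> nat \<Rightarrow> (nat \<Rightarrow> real) \<Rightarrow> bool" where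
  "zeros_enum L u m x \<longleftrightarrow>
     x 0 = 0 \<and> x (2 * m) = L \<and> strict_mono_on {0..2 * m} x
     \<and> deriv_zeros L u = {x (2 * k) |k. k \<le> m}
     \<and> inner_zeros L u = {x (2 * k + 1) |k. k < m}"

definition L1_dist_on :: "real \<Rightarrow> real \<Rightarrow> (real \<Rightarrow> real) \<Rightarrow> real \<Rightarrow> real" where
  "L1_dist_on c d a r = (LINT t|lebesgue_on {c<..<d}. \<bar>a t - r\<bar>)"

text \<open>On an open subinterval of \<open>[0,L]\<close> the two-sided \<open>deriv u\<close> is the derivative of a solution.\<close>

definition energy_diff :: "real \<Rightarrow> real \<Rightarrow> (real \<Rightarrow> real) \<Rightarrow> real \<Rightarrow> real" where
  "energy_diff c d u r =
     (LINT t|lebesgue_on {c<..<d}. (deriv u t)\<^sup>2) - r * (LINT t|lebesgue_on {c<..<d}. (u t)\<^sup>2)"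

end

theory Submission
  imports Defs
begin

text \<open>A weak solution is \<open>C\<^sup>1\<close> with \<open>w = u'\<close> absolutely continuous: \<open>w x = - \<integral>\<^sub>0\<^sup>x a u\<close>, so
  the boundary conditions become \<open>w 0 = w L = 0\<close>. Between a zero \<open>d\<close> of \<open>u'\<close> and a neighbouring zero of
  \<open>u\<close> one compares \<open>u\<close> with \<open>T x = cos (k (x - d))\<close>, where \<open>k = n \<pi> / L\<close>: since
  \<open>(u' T - u T')' = - (a - \<lambda>\<^sub>n) u T\<close> has a sign, the distance is at most \<open>\<pi> / (2 k) = L / (2 n)\<close>, with
  equality only if \<open>a = \<lambda>\<^sub>n\<close> a.e. in between. Equality in all \<open>2 m\<close> gaps would contradict
  \<open>\<lambda>\<^sub>n \<prec> a\<close>, and summing the gaps gives \<open>m > n\<close>. Part (3) is \<open>\<integral> u'\<^sup>2 = \<integral> a u\<^sup>2\<close> on each gap together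
  with the monotonicity of \<open>\<bar>u\<bar>\<close> there, and every \<open>m > n\<close> is realised by \<open>a = \<lambda>\<^sub>m\<close>,
  \<open>u = cos (m \<pi> x / L)\<close>.\<close>

subsection \<open>Test functions\<close>

text \<open>The coefficient is merely integrable, so the equation can hold only almost everywhere
  and \<open>w\<close> need not be differentiable at a given point. The equation therefore enters in
  integrated form, through an integration by parts in which one factor is continuously
  differentiable and the other is a primitive of an integrable function. A test function is defined
  by differentiability of all iterates of \<open>deriv\<close>, so smoothness of the bumps and of
  their corrections has to be proved before a weak derivative can be exploited. An end point of
  \<open>[0,L]\<close> is a zero of \<open>u'\<close>, hence, by uniqueness for the initial value
  problem, not a zero of \<open>u\<close>. This is why the extreme gaps have the same shape as the
  inner ones: every gap has one critical end and one end where \<open>u\<close> vanishes, and a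
  single comparison argument, up to reflection, covers them all.\<close>

definition smooth :: "(real \<Rightarrow> real) \<Rightarrow> bool" where
  "smooth f \<longleftrightarrow> (\<forall>k x. (deriv ^^ k) f differentiable (at x))"

text \<open>A family closed under differentiation contains every iterate of \<open>deriv\<close>.
  Thus no formula for a k-th derivative is needed; each application only names a suitable family
  \<open>S\<close>.\<close>

lemma smooth_coinduct:
  assumes "f \<in> S" and step: "\<And>g. g \<in> S \<Longrightarrow> \<exists>g'\<in>S. \<forall>x. (g has_real_derivative g' x) (at x)"
  shows "smooth f"
proof -
  have closed: "deriv g \<in> S" if g: "g \<in> S" for g
  proof -
    obtain g' where g': "g' \<in> S" "\<forall>x. (g has_real_derivative g' x) (at x)"
      using step[OF g] by blast
    then have "deriv g = g'"
      by (intro ext DERIV_imp_deriv) auto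
    with g' show ?thesis by simp
  qed
  have "(deriv ^^ k) f \<in> S" for k
    by (induction k) (auto simp: assms closed)
  then show ?thesis
    unfolding smooth_def using step real_differentiable_def by blast
qed

lemma smooth_DERIV: "smooth f \<Longrightarrow> (f has_real_derivative deriv f x) (at x)"
  unfolding smooth_def
  by (metis DERIV_deriv_iff_real_differentiable funpow_0)

lemma smooth_deriv: "smooth f \<Longrightarrow> smooth (deriv f)"
  unfolding smooth_def by (metis funpow_Suc_right o_apply)

lemma smooth_antideriv:
  assumes "smooth f" and F: "\<And>x. (F has_real_derivative f x) (at x)"
  shows "smooth F"
proof -
  have "deriv F = f" using F by (intro ext DERIV_imp_deriv) auto
  then have "(deriv ^^ k) F differentiable (at x)" for k x
    using assms(1) F[of x] unfolding smooth_def
    by (cases k) (auto simp del: funpow.simps simp add: funpow_Suc_right real_differentiable_def funpow_0)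
  then show ?thesis by (simp add: smooth_def)
qed

text \<open>Finite sums of products: the product rule leaves the set of plain products, but not the
  set of their sums.\<close>

inductive_set smooth_products :: "(real \<Rightarrow> real) set" where
  prod: "smooth f \<Longrightarrow> smooth g \<Longrightarrow> (\<lambda>x. f x * g x) \<in> smooth_products"
| add: "f \<in> smooth_products \<Longrightarrow> g \<in> smooth_products \<Longrightarrow> (\<lambda>x. f x + g x) \<in> smooth_products"

lemma smooth_mult:
  assumes "smooth f" "smooth g"
  shows "smooth (\<lambda>x. f x * g x)"
proof (rule smooth_coinduct)
  show "(\<lambda>x. f x * g x) \<in> smooth_products"
    using assms by (rule smooth_products.prod)
next
  fix h assume "h \<in> smooth_products"
  then show "\<exists>h'\<in>smooth_products. \<forall>x. (h has_real_derivative h' x) (at x)"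
  proof induction
    case (prod f g)
    show ?case
    proof (intro bexI allI)
      show "(\<lambda>x. deriv f x * g x + f x * deriv g x) \<in> smooth_products"
        by (intro smooth_products.intros prod smooth_deriv)
      show "((\<lambda>x. f x * g x) has_real_derivative deriv f x * g x + f x * deriv g x) (at x)" for x
        using prod[THEN smooth_DERIV, of x] by (auto intro!: derivative_eq_intros)
    qed
  next
    case (add f g)
    then obtain f' g' where *: "f' \<in> smooth_products" "g' \<in> smooth_products"
      "\<And>x. (f has_real_derivative f' x) (at x)" "\<And>x. (g has_real_derivative g' x) (at x)"
      by blast
    then show ?case
      by (intro bexI[of _ "\<lambda>x. f' x + g' x"] allI DERIV_add smooth_products.intros)
  qed
qed

lemma smooth_lincomb:
  assumes "smooth f" "smooth g"
  shows "smooth (\<lambda>x. \<alpha> * f x + \<beta> * g x)"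
proof (rule smooth_coinduct)
  show "(\<lambda>x. \<alpha> * f x + \<beta> * g x) \<in> {(\<lambda>x. \<alpha> * f x + \<beta> * g x) |f g. smooth f \<and> smooth g}"
    using assms by blast
next
  fix h assume "h \<in> {(\<lambda>x. \<alpha> * f x + \<beta> * g x) |f g. smooth f \<and> smooth g}"
  then obtain f g where h: "h = (\<lambda>x. \<alpha> * f x + \<beta> * g x)" "smooth f" "smooth g" by blast
  then have "(h has_real_derivative \<alpha> * deriv f x + \<beta> * deriv g x) (at x)" for x
    using h(2,3)[THEN smooth_DERIV, of x] unfolding h(1) by (auto intro!: derivative_eq_intros)
  then show "\<exists>h'\<in>{(\<lambda>x. \<alpha> * f x + \<beta> * g x) |f g. smooth f \<and> smooth g}.
               \<forall>x. (h has_real_derivative h' x) (at x)"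
    using h(2,3) smooth_deriv by (intro bexI[of _ "\<lambda>x. \<alpha> * deriv f x + \<beta> * deriv g x"]) auto
qed

text \<open>The family used here carries a scalar \<alpha>, which absorbs the factor
  \<open>c\<close> produced by the chain rule.\<close>

lemma smooth_affine:
  assumes "smooth f"
  shows "smooth (\<lambda>x. f (c * x + d))"
proof (rule smooth_coinduct)
  show "(\<lambda>x. f (c * x + d)) \<in> {(\<lambda>x. \<alpha> * f (c * x + d)) |\<alpha> f. smooth f}"
    using assms by (intro CollectI exI[of _ 1] exI[of _ f]) auto
next
  fix h assume "h \<in> {(\<lambda>x. \<alpha> * f (c * x + d)) |\<alpha> f. smooth f}"
  then obtain \<alpha> f where h: "h = (\<lambda>x. \<alpha> * f (c * x + d))" "smooth f" by blast
  have "(h has_real_derivative (\<alpha> * c) * deriv f (c * x + d)) (at x)" for x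
    unfolding h(1)
    by (rule derivative_eq_intros DERIV_chain2[OF smooth_DERIV[OF h(2)]] refl | simp)+
  then show "\<exists>h'\<in>{(\<lambda>x. \<alpha> * f (c * x + d)) |\<alpha> f. smooth f}. \<forall>x. (h has_real_derivative h' x) (at x)"
    using h(2) smooth_deriv by (intro bexI[of _ "\<lambda>x. (\<alpha> * c) * deriv f (c * x + d)"]) auto
qed

section \<open>Bump functions\<close>

definition flat_exp :: "real \<Rightarrow> real" where
  "flat_exp x = (if x > 0 then exp (- (1 / x)) else 0)"

lemma tendsto_poly_exp_minus: "((\<lambda>y. poly p y * exp (- y)) \<longlongrightarrow> (0::real)) at_top"
proof -
  have "((\<lambda>y. \<Sum>i\<le>degree p. coeff p i * (y ^ i / exp y)) \<longlongrightarrow> (\<Sum>i\<le>degree p. coeff p i * 0)) at_top"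
    by (intro tendsto_intros tendsto_power_div_exp_0)
  moreover have "(\<lambda>y. \<Sum>i\<le>degree p. coeff p i * (y ^ i / exp y)) = (\<lambda>y. poly p y * exp (- y))"
    by (simp add: poly_altdef sum_distrib_right exp_minus divide_inverse mult.assoc)
  ultimately show ?thesis by simp
qed

text \<open>On the positive axis every derivative is a polynomial in \<open>1 / x\<close> times the
  same exponential, and the exponential beats the polynomial at 0. The functions of this shape,
  extended by zero, form the closed family.\<close>

lemma smooth_flat_exp: "smooth flat_exp"
proof (rule smooth_coinduct)
  let ?g = "\<lambda>p x. if x > (0::real) then poly p (1 / x) * exp (- (1 / x)) else (0::real)"
  show "flat_exp \<in> {?g p |p. True}"
    by (intro CollectI exI[of _ 1]) (auto simp: flat_exp_def)
  fix h assume "h \<in> {?g p |p. True}"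
  then obtain p where h: "h = ?g p" by blast
  \<comment> \<open>With \<open>y = 1 / x\<close> and \<open>dy/dx = - y^2\<close>, the derivative
    of \<open>p(y) exp(-y)\<close> is \<open>y^2 (p(y) - p'(y)) exp(-y)\<close>.\<close>
  define q where "q = monom 1 2 * (p - pderiv p)"
  have "(h has_real_derivative ?g q x) (at x)" for x
  proof -
    consider "x > 0" | "x < 0" | "x = 0" by linarith
    then show ?thesis
    proof cases
      case 1
      have D: "((\<lambda>x. poly p (1 / x) * exp (- (1 / x))) has_real_derivative ?g q x) (at x)"
      proof -
        have d: "((\<lambda>x. 1 / x) has_real_derivative - (1 / x\<^sup>2)) (at x)"
          using 1 by (auto intro!: derivative_eq_intros simp: power2_eq_square)
        have "((\<lambda>x. exp (- (1 / x))) has_real_derivative exp (- (1 / x)) * (1 / x\<^sup>2)) (at x)"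
          using DERIV_chain2[OF DERIV_exp DERIV_minus[OF d]] by simp
        from DERIV_mult[OF DERIV_chain2[OF poly_DERIV d] this] show ?thesis
          by (rule DERIV_cong) (use 1 in \<open>simp add: q_def poly_monom algebra_simps power_one_over\<close>)
      qed
      have "eventually (\<lambda>y. y > 0) (nhds x)"
        using eventually_nhds_in_open[of "{0<..}" x] 1 by simp
      then have ev: "eventually (\<lambda>y. h y = poly p (1 / y) * exp (- (1 / y))) (nhds x)"
        by eventually_elim (simp add: h)
      show ?thesis
        using D by (simp only: DERIV_cong_ev[OF refl ev refl])
    next
      case 2
      have "eventually (\<lambda>y. y < 0) (nhds x)"
        using eventually_nhds_in_open[of "{..<0}" x] 2 by simp
      then have ev: "eventually (\<lambda>y. h y = 0) (nhds x)"
        by eventually_elim (simp add: h)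
      have D: "((\<lambda>y. 0) has_real_derivative ?g q x) (at x)"
        using 2 by simp
      show ?thesis
        using D by (simp only: DERIV_cong_ev[OF refl ev refl])
    next
      case 3
      \<comment> \<open>The difference quotient at 0 has an extra factor \<open>1 / y\<close>, which
        is absorbed by multiplying \<open>p\<close> by the variable, that is, by
        \<open>pCons 0 p\<close>.\<close>
      have "((\<lambda>y. poly (pCons 0 p) (inverse y) * exp (- inverse y)) \<longlongrightarrow> 0) (at_right 0)"
        by (rule filterlim_compose[OF tendsto_poly_exp_minus filterlim_inverse_at_top_right])
      moreover have "eventually (\<lambda>y. poly (pCons 0 p) (inverse y) * exp (- inverse y) = (h y - h 0) / (y - 0))
          (at_right 0)"
        unfolding eventually_at_filter by (auto simp: h field_simps)
      ultimately have r: "((\<lambda>y. (h y - h 0) / (y - 0)) \<longlongrightarrow> 0) (at_right 0)"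
        by (rule Lim_transform_eventually)
      have "eventually (\<lambda>y. 0 = (h y - h 0) / (y - 0)) (at_left 0)"
        unfolding eventually_at_filter by (auto simp: h)
      then have "((\<lambda>y. (h y - h 0) / (y - 0)) \<longlongrightarrow> 0) (at_left 0)"
        by (rule Lim_transform_eventually[OF tendsto_const])
      with r have "((\<lambda>y. (h y - h 0) / (y - 0)) \<longlongrightarrow> 0) (at 0)"
        by (simp add: filterlim_at_split)
      then show ?thesis
        using 3 by (simp add: has_field_derivative_iff)
    qed
  qed
  then show "\<exists>h'\<in>{?g p |p. True}. \<forall>x. (h has_real_derivative h' x) (at x)"
    by (intro bexI[of _ "?g q"] allI CollectI exI[of _ q] conjI refl TrueI)
qed

lemma test_function_iff:
  "test_function L \<phi> \<longleftrightarrow> smooth \<phi> \<and> (\<exists>c d. 0 < c \<and> d < L \<and> (\<forall>x. x \<notin> {c..d} \<longrightarrow> \<phi> x = 0))"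
  by (simp add: test_function_def smooth_def)

text \<open>A bump with support in \<open>[s,t]\<close>. The growing factor steepens both flanks, so
  that the bumps tend to the indicator of the open interval while staying below 1. With
  \<open>Suc k\<close> in place of \<open>k\<close> the bump for index 0 is already nonzero; it
  later serves as the fixed bump \<eta>.\<close>

definition cutoff :: "real \<Rightarrow> real \<Rightarrow> nat \<Rightarrow> real \<Rightarrow> real" where
  "cutoff s t k x = flat_exp (real (Suc k) * (x - s)) * flat_exp (real (Suc k) * (t - x))"

lemma smooth_cutoff: "smooth (cutoff s t k)"
proof -
  have eq: "cutoff s t k = (\<lambda>x. flat_exp (real (Suc k) * x + - real (Suc k) * s) *
      flat_exp ((- real (Suc k)) * x + real (Suc k) * t))"
    by (simp add: cutoff_def fun_eq_iff right_diff_distrib del: of_nat_Suc)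
  show ?thesis
    unfolding eq by (rule smooth_mult[OF smooth_affine[OF smooth_flat_exp] smooth_affine[OF smooth_flat_exp]])
qed

lemma cutoff_eq_0: "x \<notin> {s<..<t} \<Longrightarrow> cutoff s t k x = 0"
  by (auto simp: cutoff_def flat_exp_def zero_less_mult_iff)

lemma cutoff_pos: "x \<in> {s<..<t} \<Longrightarrow> cutoff s t k x > 0"
  by (auto simp: cutoff_def flat_exp_def zero_less_mult_iff)

lemma cutoff_nonneg: "cutoff s t k x \<ge> 0"
  using cutoff_eq_0 cutoff_pos by (metis order_less_imp_le order_refl)

lemma cutoff_le_1: "cutoff s t k x \<le> 1"
proof -
  have "0 \<le> flat_exp y" "flat_exp y \<le> 1" for y by (auto simp: flat_exp_def)
  then show ?thesis unfolding cutoff_def by (simp add: mult_le_one)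
qed

lemma test_function_cutoff: "0 < s \<Longrightarrow> t < L \<Longrightarrow> test_function L (cutoff s t k)"
  unfolding test_function_iff using smooth_cutoff cutoff_eq_0
  by (intro conjI exI[of _ s] exI[of _ t]) auto

lemma tendsto_cutoff: "(\<lambda>k. cutoff s t k x) \<longlonglongrightarrow> indicator {s<..<t} x"
proof (cases "x \<in> {s<..<t}")
  case True
  have lim: "(\<lambda>k. flat_exp (real (Suc k) * y)) \<longlonglongrightarrow> 1" if "y > 0" for y
  proof -
    have "(\<lambda>k. exp (- (inverse (real (Suc k)) * (1 / y)))) \<longlonglongrightarrow> exp (- (0 * (1 / y)))"
      by (intro tendsto_intros LIMSEQ_inverse_real_of_nat)
    moreover have "exp (- (inverse (real (Suc k)) * (1 / y))) = flat_exp (real (Suc k) * y)" for k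
      using that by (simp add: flat_exp_def zero_less_mult_iff divide_inverse)
    ultimately show ?thesis by simp
  qed
  have "(\<lambda>k. cutoff s t k x) \<longlonglongrightarrow> 1 * 1"
    unfolding cutoff_def using True by (intro tendsto_mult lim) auto
  with True show ?thesis by simp
next
  case False
  then show ?thesis using cutoff_eq_0 by simp
qed

subsection \<open>The fundamental lemma and integration by parts\<close>

lemma AE_lebesgue_on_iff_negligible:
  assumes "S \<in> sets lebesgue"
  shows "(AE x in lebesgue_on S. P x) \<longleftrightarrow> negligible {x \<in> S. \<not> P x}"
proof -
  have "(AE x in lebesgue_on S. P x) \<longleftrightarrow> (AE x in lebesgue. x \<in> S \<longrightarrow> P x)"
    using assms by (simp add: AE_restrict_space_iff)
  also have "\<dots> \<longleftrightarrow> negligible {x \<in> S. \<not> P x}"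
    unfolding eventually_ae_filter_negligible
    by (auto intro: negligible_subset)
  finally show ?thesis .
qed

lemma absolutely_integrable_on_iff_integrable_lebesgue_on:
  fixes f :: "'a::euclidean_space \<Rightarrow> 'b::euclidean_space"
  assumes "S \<in> sets lebesgue"
  shows "f absolutely_integrable_on S \<longleftrightarrow> integrable (lebesgue_on S) f"
  using assms by (simp add: set_integrable_def integrable_restrict_space)

lemma integrable_lebesgue_on_Ioo_iff:
  fixes f :: "real \<Rightarrow> real"
  shows "integrable (lebesgue_on {p<..<q}) f \<longleftrightarrow> f absolutely_integrable_on {p..q}"
  by (simp add: absolutely_integrable_on_Icc_iff_Ioo absolutely_integrable_on_iff_integrable_lebesgue_on)

lemma integral_lebesgue_on_Ioo:
  fixes f :: "real \<Rightarrow> real"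
  assumes "f absolutely_integrable_on {p..q}"
  shows "integral\<^sup>L (lebesgue_on {p<..<q}) f = integral {p..q} f"
  using assms lebesgue_integral_eq_integral[of "{p<..<q}" f]
  by (simp add: integrable_lebesgue_on_Ioo_iff integral_open_interval_real)

lemma absolutely_integrable_imp_abs_integrable:
  fixes f :: "'a::euclidean_space \<Rightarrow> real"
  assumes "f absolutely_integrable_on S"
  shows "(\<lambda>x. \<bar>f x\<bar>) integrable_on S"
  using assms by (simp add: absolutely_integrable_on_def)

text \<open>Off a null set \<open>f\<close> equals its absolute value. This makes the absolute value
  integrable with integral 0, and the Lebesgue theory of nonnegative functions applies.\<close>

lemma negligible_nonzero_if_integral_nonneg_0:
  fixes f :: "real \<Rightarrow> real"
  assumes "f integrable_on {p..q}" "negligible {x \<in> {p..q}. \<not> 0 \<le> f x}" "integral {p..q} f = 0"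
  shows "negligible {x \<in> {p..q}. \<not> f x = 0}"
proof -
  let ?N = "{x \<in> {p..q}. \<not> 0 \<le> f x}"
  have int: "(\<lambda>x. \<bar>f x\<bar>) integrable_on {p..q}"
    by (rule integrable_spike[OF assms(1,2)]) auto
  have "integral {p..q} (\<lambda>x. \<bar>f x\<bar>) = integral {p..q} f"
    by (rule integral_spike[OF assms(2)]) auto
  moreover have ai: "(\<lambda>x. \<bar>f x\<bar>) absolutely_integrable_on {p..q}"
    using int by (simp add: absolutely_integrable_on_iff_nonneg)
  ultimately have "integral\<^sup>L (lebesgue_on {p..q}) (\<lambda>x. \<bar>f x\<bar>) = 0"
    using assms(3) by (simp add: lebesgue_integral_eq_integral absolutely_integrable_on_iff_integrable_lebesgue_on)
  then have "AE x in lebesgue_on {p..q}. \<bar>f x\<bar> = 0"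
    using ai by (subst (asm) integral_nonneg_eq_0_iff_AE)
      (auto simp: absolutely_integrable_on_iff_integrable_lebesgue_on)
  then show ?thesis
    by (simp add: AE_lebesgue_on_iff_negligible)
qed

lemma integral_le_ae:
  fixes f g :: "'a::euclidean_space \<Rightarrow> real"
  assumes "f integrable_on S" "g integrable_on S" "negligible N" "\<And>x. x \<in> S - N \<Longrightarrow> f x \<le> g x"
  shows "integral S f \<le> integral S g"
proof -
  let ?g = "\<lambda>x. if x \<in> N then f x else g x"
  have "?g integrable_on S"
    by (rule integrable_spike[OF assms(2,3)]) auto
  then have "integral S f \<le> integral S ?g"
    using assms by (intro integral_le) auto
  also have "\<dots> = integral S g"
    by (rule integral_spike[OF assms(3)]) auto
  finally show ?thesis .
qed

lemma absolutely_integrable_mult_continuous: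
  fixes f g :: "real \<Rightarrow> real"
  assumes "f absolutely_integrable_on {p..q}" "continuous_on {p..q} g"
  shows "(\<lambda>x. f x * g x) absolutely_integrable_on {p..q}"
proof -
  have "bounded (g ` {p..q})"
    by (intro compact_imp_bounded compact_continuous_image assms) auto
  then have "(\<lambda>x. g x * f x) absolutely_integrable_on {p..q}"
    using assms by (intro absolutely_integrable_bounded_measurable_product_real
        continuous_imp_measurable_on_sets_lebesgue) auto
  then show ?thesis by (simp add: mult.commute)
qed

lemma absolutely_integrable_on_Icc_subset:
  fixes f :: "real \<Rightarrow> real"
  assumes "f absolutely_integrable_on {p..q}" "p \<le> s" "t \<le> q"
  shows "f absolutely_integrable_on {s..t}"
  using absolutely_integrable_on_subinterval[OF assms(1)] assms(2,3) by (simp add: atLeastatMost_subset_iff)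

lemma integrable_on_Icc_subset:
  fixes f :: "real \<Rightarrow> real"
  assumes "f absolutely_integrable_on {p..q}" "p \<le> s" "t \<le> q"
  shows "f integrable_on {s..t}"
  by (rule set_lebesgue_integral_eq_integral(1)[OF absolutely_integrable_on_Icc_subset[OF assms]])

text \<open>By the Henstock lemma the Riemann sums of \<open>\<bar>f\<bar>\<close> are small, since every summand of the sum for
  \<open>f\<close> is compared with the integral over its own interval, which is zero.\<close>

lemma negligible_nonzero_if_integrals_0:
  fixes f :: "real \<Rightarrow> real"
  assumes "f integrable_on {p..q}"
    and zero: "\<And>s t. p \<le> s \<Longrightarrow> s \<le> t \<Longrightarrow> t \<le> q \<Longrightarrow> integral {s..t} f = 0"
  shows "negligible {x \<in> {p..q}. \<not> f x = 0}"
proof -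
  have "((\<lambda>x. \<bar>f x\<bar>) has_integral 0) (cbox p q)"
    unfolding has_integral
  proof (intro allI impI)
    fix e :: real assume "e > 0"
    obtain \<gamma> where \<gamma>: "gauge \<gamma>"
      "\<And>D. D tagged_partial_division_of cbox p q \<Longrightarrow> \<gamma> fine D \<Longrightarrow>
         (\<Sum>(x,K)\<in>D. norm (measure lborel K *\<^sub>R f x - integral K f)) < e"
      using Henstock_lemma[of f p q e] assms(1) \<open>e > 0\<close> by auto
    show "\<exists>\<gamma>. gauge \<gamma> \<and> (\<forall>D. D tagged_division_of cbox p q \<and> \<gamma> fine D \<longrightarrow>
            norm ((\<Sum>(x,K)\<in>D. measure lborel K *\<^sub>R \<bar>f x\<bar>) - 0) < e)"
    proof (intro exI conjI allI impI)
      fix D assume D: "D tagged_division_of cbox p q \<and> \<gamma> fine D"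
      have "norm ((\<Sum>(x,K)\<in>D. measure lborel K *\<^sub>R \<bar>f x\<bar>) - 0) \<le> (\<Sum>(x,K)\<in>D. measure lborel K * \<bar>f x\<bar>)"
        by (auto intro!: sum_nonneg)
      also have "\<dots> = (\<Sum>(x,K)\<in>D. norm (measure lborel K *\<^sub>R f x - integral K f))"
      proof (rule sum.cong[OF refl], clarify)
        fix x K assume "(x, K) \<in> D"
        with D obtain s t where K: "K = cbox s t" "K \<subseteq> cbox p q" "x \<in> K"
          by (meson tagged_division_ofD(2-4))
        then have "integral K f = 0"
          using zero[of s t] by auto
        then show "measure lborel K * \<bar>f x\<bar> = norm (measure lborel K *\<^sub>R f x - integral K f)"
          by (simp add: abs_mult)
      qed
      also have "\<dots> < e"
        using D by (intro \<gamma>) (auto simp: tagged_division_of_def)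
      finally show "norm ((\<Sum>(x,K)\<in>D. measure lborel K *\<^sub>R \<bar>f x\<bar>) - 0) < e" .
    qed (rule \<gamma>)
  qed
  then have "negligible {x \<in> {p..q}. \<not> \<bar>f x\<bar> = 0}"
    by (intro negligible_nonzero_if_integral_nonneg_0) (auto simp: integral_unique has_integral_integrable)
  then show ?thesis by simp
qed

section \<open>Testing against smooth functions\<close>

lemma smooth_continuous_on: "smooth \<phi> \<Longrightarrow> continuous_on S \<phi>"
  by (rule DERIV_continuous_on) (rule has_field_derivative_at_within[OF smooth_DERIV])

text \<open>The cutoffs of \<open>(s,t)\<close> converge boundedly to its indicator, so by dominated
  convergence \<open>f\<close> has integral zero over every interval inside the open interval from 0
  to \<open>L\<close>. This determines \<open>f\<close> almost everywhere.\<close>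

lemma fundamental_lemma_variations:
  fixes f :: "real \<Rightarrow> real"
  assumes L: "L > 0" and f: "f absolutely_integrable_on {0..L}"
    and test: "\<And>\<theta>. test_function L \<theta> \<Longrightarrow> integral {0..L} (\<lambda>x. f x * \<theta> x) = 0"
  shows "negligible {x \<in> {0..L}. \<not> f x = 0}"
proof (rule negligible_nonzero_if_integrals_0)
  note fi = integrable_on_Icc_subset[OF f]
  show f_int: "f integrable_on {0..L}"
    using fi[of 0 L] by simp
  have inner: "integral {s..t} f = 0" if st: "0 < s" "s \<le> t" "t < L" for s t
  proof -
    have "(\<lambda>k. integral {0..L} (\<lambda>x. f x * cutoff s t k x)) \<longlonglongrightarrow>
            integral {0..L} (\<lambda>x. f x * indicator {s<..<t} x)"
    proof (rule dominated_convergence(2))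
      show "(\<lambda>x. f x * cutoff s t k x) integrable_on {0..L}" for k
      proof -
        have "continuous_on {0..L} (cutoff s t k)"
          by (rule smooth_continuous_on[OF smooth_cutoff])
        from absolutely_integrable_mult_continuous[OF f this] show ?thesis
          using set_lebesgue_integral_eq_integral(1) by blast
      qed
      show "(\<lambda>x. \<bar>f x\<bar>) integrable_on {0..L}"
        using f by (rule absolutely_integrable_imp_abs_integrable)
      show "norm (f x * cutoff s t k x) \<le> \<bar>f x\<bar>" for k x
        using cutoff_le_1[of s t k x] cutoff_nonneg[of s t k x] by (simp add: abs_mult mult_left_le)
      show "(\<lambda>k. f x * cutoff s t k x) \<longlonglongrightarrow> f x * indicator {s<..<t} x" for x
        by (intro tendsto_intros tendsto_cutoff)
    qed
    moreover have "integral {0..L} (\<lambda>x. f x * cutoff s t k x) = 0" for k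
      using st by (intro test test_function_cutoff)
    ultimately have "integral {0..L} (\<lambda>x. f x * indicator {s<..<t} x) = 0"
      by (simp add: LIMSEQ_const_iff)
    moreover have "integral {0..L} (\<lambda>x. f x * indicator {s<..<t} x) = integral ({0..L} \<inter> {s<..<t}) f"
    proof -
      have "(\<lambda>x. f x * indicator {s<..<t} x) = (\<lambda>x. if x \<in> {s<..<t} then f x else 0)"
        by (auto simp: indicator_def)
      then show ?thesis by (simp only: integral_restrict_Int Int_commute)
    qed
    moreover have "{0..L} \<inter> {s<..<t} = {s<..<t}"
      using st by auto
    ultimately show ?thesis
      by (simp add: integral_open_interval_real)
  qed
  have combine: "integral {0..s} f + integral {s..t} f = integral {0..t} f" if "0 \<le> s" "s \<le> t" "t \<le> L" for s t
    using that by (intro Henstock_Kurzweil_Integration.integral_combine fi) auto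
  \<comment> \<open>Cutoffs do not reach the end points. The interior intervals make the primitive
    constant on the open interval, with the midpoint as reference, and continuity carries this to 0
    and \<open>L\<close>.\<close>
  have F: "integral {0..x} f = integral {0..L/2} f" if "x \<in> {0..L}" for x
  proof (rule continuous_constant_on_closure[of "{0<..<L}" "\<lambda>x. integral {0..x} f"])
    show "continuous_on (closure {0<..<L}) (\<lambda>x. integral {0..x} f)"
      using L f_int by (simp add: indefinite_integral_continuous_1)
    show "integral {0..y} f = integral {0..L/2} f" if "y \<in> {0<..<L}" for y
      using that combine[of y "L/2"] combine[of "L/2" y] inner[of y "L/2"] inner[of "L/2" y] L
      by (cases "y \<le> L/2") auto
    show "x \<in> closure {0<..<L}"
      using that L by simp
  qed
  show "integral {s..t} f = 0" if "0 \<le> s" "s \<le> t" "t \<le> L" for s t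
    using combine[OF that] F[of s] F[of t] that by simp
qed

text \<open>A test function must be differentiable on the whole line, whereas for negative
  \<open>x\<close> the integral runs over an empty set. Support to the right of \<open>c > 0\<close>
  reconciles the two: near any \<open>x < c\<close> the primitive is zero.\<close>

lemma has_real_derivative_integral_compact_support:
  fixes \<psi> :: "real \<Rightarrow> real"
  assumes "0 < c" and \<psi>: "continuous_on UNIV \<psi>" and supp: "\<And>x. x \<notin> {c..d} \<Longrightarrow> \<psi> x = 0"
  shows "((\<lambda>x. integral {0..x} \<psi>) has_real_derivative \<psi> x) (at x)"
proof (cases "x < c")
  case True
  have "eventually (\<lambda>y. y < c) (nhds x)"
    using eventually_nhds_in_open[of "{..<c}" x] True by simp
  then have ev: "eventually (\<lambda>y. integral {0..y} \<psi> = 0) (nhds x)"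
  proof eventually_elim
    case (elim y)
    have "integral {0..y} \<psi> = integral {0..y} (\<lambda>_. 0)"
      using elim supp by (intro integral_cong) auto
    then show ?case by simp
  qed
  have "((\<lambda>y. 0) has_real_derivative \<psi> x) (at x)"
    using True supp[of x] by simp
  then show ?thesis
    by (simp only: DERIV_cong_ev[OF refl ev refl])
next
  case False
  have "((\<lambda>x. integral {0..x} \<psi>) has_real_derivative \<psi> x) (at x within {0..x+1})"
    using False \<open>0 < c\<close> by (intro integral_has_real_derivative continuous_on_subset[OF \<psi>]) auto
  then show ?thesis
    using False \<open>0 < c\<close> by (simp add: at_within_Icc_at)
qed

text \<open>Subtracting a multiple of a fixed bump \<open>\<eta>\<close> turns an arbitrary test function into one of mean
  zero, that is, into the derivative of a test function.\<close>

lemma du_bois_reymond: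
  fixes f :: "real \<Rightarrow> real"
  assumes L: "L > 0" and f: "f absolutely_integrable_on {0..L}"
    and test: "\<And>\<phi>. test_function L \<phi> \<Longrightarrow> integral {0..L} (\<lambda>x. f x * deriv \<phi> x) = 0"
  shows "\<exists>c. negligible {x \<in> {0..L}. \<not> f x = c}"
proof -
  define \<eta> where "\<eta> = cutoff (L/3) (2*L/3) 0"
  have \<eta>: "test_function L \<eta>" "smooth \<eta>"
    using L by (auto simp: \<eta>_def smooth_cutoff intro!: test_function_cutoff)
  note cont = smooth_continuous_on
  have int: "\<theta> integrable_on {s..t}" if "smooth \<theta>" for \<theta> s t
    using cont[OF that] by (rule integrable_continuous_real)
  have fint: "(\<lambda>x. f x * \<theta> x) integrable_on {0..L}" if "smooth \<theta>" for \<theta>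
    using absolutely_integrable_mult_continuous[OF f cont[OF that]] set_lebesgue_integral_eq_integral(1) by blast
  have I: "integral {0..L} \<eta> \<noteq> 0"
  proof
    assume "integral {0..L} \<eta> = 0"
    then have "\<forall>x\<in>{0..L}. \<eta> x = 0"
      using L \<eta> by (subst (asm) integral_eq_0_iff) (auto intro!: cont simp: \<eta>_def cutoff_nonneg)
    then have "\<eta> (L/2) = 0" using L by simp
    moreover have "\<eta> (L/2) > 0" unfolding \<eta>_def using L by (intro cutoff_pos) auto
    ultimately show False by simp
  qed
  \<comment> \<open>The only candidate: if \<open>f\<close> is almost everywhere equal to a
    constant, integrating against \<eta> yields this quotient.\<close>
  define c where "c = integral {0..L} (\<lambda>x. f x * \<eta> x) / integral {0..L} \<eta>"
  have "negligible {x \<in> {0..L}. \<not> f x - c = 0}"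
  proof (rule fundamental_lemma_variations[OF L])
    show "(\<lambda>x. f x - c) absolutely_integrable_on {0..L}"
      by (rule set_integral_diff(1)[OF f absolutely_integrable_on_const]) simp
  next
    fix \<theta> assume \<theta>: "test_function L \<theta>"
    then have s\<theta>: "smooth \<theta>" by (simp add: test_function_iff)
    define J where "J = integral {0..L} \<theta> / integral {0..L} \<eta>"
    define \<psi> where "\<psi> = (\<lambda>x. 1 * \<theta> x + (- J) * \<eta> x)"
    have s\<psi>: "smooth \<psi>"
      unfolding \<psi>_def using s\<theta> \<eta>(2) by (rule smooth_lincomb)
    obtain c1 d1 c2 d2 where cd: "0 < c1" "d1 < L" "\<And>x. x \<notin> {c1..d1} \<Longrightarrow> \<theta> x = 0"
       "0 < c2" "d2 < L" "\<And>x. x \<notin> {c2..d2} \<Longrightarrow> \<eta> x = 0"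
      using \<theta> \<eta>(1) by (fastforce simp: test_function_iff)
    \<comment> \<open>The maximum with 0 ensures \<open>0 \<le> d3\<close>, so that integrals from 0
      can be split at \<open>d3\<close>; the bounds \<open>d1\<close> and \<open>d2\<close> may be
      negative.\<close>
    define c3 d3 where "c3 = min c1 c2" and "d3 = max 0 (max d1 d2)"
    have cd3: "0 < c3" "0 \<le> d3" "d3 < L" "\<And>x. x \<notin> {c3..d3} \<Longrightarrow> \<psi> x = 0"
      using cd L by (auto simp: c3_def d3_def \<psi>_def min_def max_def split: if_splits)
    define \<phi> where "\<phi> = (\<lambda>x. integral {0..x} \<psi>)"
    have D\<phi>: "(\<phi> has_real_derivative \<psi> x) (at x)" for x
      unfolding \<phi>_def using cd3 cont[OF s\<psi>] by (intro has_real_derivative_integral_compact_support) auto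
    have "integral {0..L} \<psi> = integral {0..L} \<theta> + (- J) * integral {0..L} \<eta>"
      unfolding \<psi>_def
      using Henstock_Kurzweil_Integration.integral_add[OF integrable_on_mult_right[OF int[OF s\<theta>], of 1 0 L]
          integrable_on_mult_right[OF int[OF \<eta>(2)], of "- J" 0 L]]
      by simp
    then have mean0: "integral {0..L} \<psi> = 0"
      using I by (simp add: J_def)
    have tail: "integral {0..x} \<psi> = integral {0..d3} \<psi>" if "x > d3" for x
    proof -
      have "integral {d3..x} \<psi> = integral {d3..x} (\<lambda>_. 0)"
        by (rule integral_spike[of "{d3}"]) (use cd3(4) in auto)
      then show ?thesis
        using Henstock_Kurzweil_Integration.integral_combine[of 0 d3 x \<psi>] that cd3 int[OF s\<psi>] by simp
    qed
    have "\<phi> x = 0" if "x \<notin> {c3..d3}" for x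
    proof (cases "x < c3")
      case True
      have "integral {0..x} \<psi> = integral {0..x} (\<lambda>_. 0)"
        by (rule integral_cong) (use cd3(4) True in auto)
      then show ?thesis by (simp add: \<phi>_def)
    next
      case False
      then show ?thesis
        using that tail[of x] tail[of L] mean0 cd3 by (simp add: \<phi>_def)
    qed
    then have "test_function L \<phi>"
      unfolding test_function_iff using cd3 smooth_antideriv[OF s\<psi> D\<phi>] by blast
    then have "integral {0..L} (\<lambda>x. f x * deriv \<phi> x) = 0"
      by (rule test)
    moreover have "deriv \<phi> = \<psi>"
      using D\<phi> by (intro ext DERIV_imp_deriv)
    ultimately have "0 = integral {0..L} (\<lambda>x. f x * \<psi> x)" by simp
    also have "\<dots> = integral {0..L} (\<lambda>x. f x * \<theta> x + (- J) * (f x * \<eta> x))"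
      by (simp add: \<psi>_def algebra_simps)
    also have "\<dots> = integral {0..L} (\<lambda>x. f x * \<theta> x) + (- J) * integral {0..L} (\<lambda>x. f x * \<eta> x)"
      using Henstock_Kurzweil_Integration.integral_add[OF fint[OF s\<theta>]
          integrable_on_mult_right[OF fint[OF \<eta>(2)], of "- J"]]
      by simp
    also have "\<dots> = integral {0..L} (\<lambda>x. f x * \<theta> x) - c * integral {0..L} \<theta>"
      by (simp add: J_def c_def)
    also have "\<dots> = integral {0..L} (\<lambda>x. f x * \<theta> x) - integral {0..L} (\<lambda>x. c * \<theta> x)"
      by simp
    also have "\<dots> = integral {0..L} (\<lambda>x. f x * \<theta> x - c * \<theta> x)"
      using fint[OF s\<theta>] int[OF s\<theta>]
      by (subst Henstock_Kurzweil_Integration.integral_diff) (auto intro!: integrable_on_mult_right)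
    finally show "integral {0..L} (\<lambda>x. (f x - c) * \<theta> x) = 0"
      by (simp add: algebra_simps)
  qed
  then show ?thesis by (intro exI[of _ c]) simp
qed

text \<open>The difference \<open>\<Phi>\<close> of the two sides satisfies
  \<open>\<bar>\<Phi> y - \<Phi> x\<bar> \<le> 2 C \<bar>y - x\<bar> \<bar>B y - B x\<bar>\<close> with \<open>B\<close> a continuous primitive of \<open>\<bar>h\<bar>\<close>, so its
  derivative vanishes at every point and not just almost everywhere.\<close>

lemma integral_by_parts_indefinite:
  fixes F f h w :: "real \<Rightarrow> real"
  assumes "p \<le> q"
    and F: "\<And>x. x \<in> {p..q} \<Longrightarrow> (F has_real_derivative f x) (at x within {p..q})"
    and f: "continuous_on {p..q} f"
    and h: "h absolutely_integrable_on {p..q}"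
    and w: "\<And>x. x \<in> {p..q} \<Longrightarrow> w x = w p + integral {p..x} h"
  shows "integral {p..q} (\<lambda>x. F x * h x + f x * w x) = F q * w q - F p * w p"
proof -
  have Fc: "continuous_on {p..q} F"
    using F by (rule DERIV_continuous_on)
  have h_int: "h integrable_on {p..q}" "(\<lambda>x. \<bar>h x\<bar>) integrable_on {p..q}"
    by (rule set_lebesgue_integral_eq_integral(1)[OF h], rule absolutely_integrable_imp_abs_integrable[OF h])
  have wc: "continuous_on {p..q} w"
    using continuous_on_add[OF continuous_on_const indefinite_integral_continuous_1[OF h_int(1)], of "w p"]
    by (rule continuous_on_eq) (rule w[symmetric])
  define g where "g = (\<lambda>x. F x * h x + f x * w x)"
  have Fh: "(\<lambda>x. F x * h x) absolutely_integrable_on {p..q}"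
    using absolutely_integrable_mult_continuous[OF h Fc] by (simp add: mult.commute)
  have fw: "(\<lambda>x. f x * w x) absolutely_integrable_on {p..q}"
    by (intro absolutely_integrable_continuous_real continuous_intros f wc)
  have g: "g absolutely_integrable_on {p..q}"
    unfolding g_def using Fh fw by (rule set_integral_add)
  note sub = integrable_on_Icc_subset
  have habs: "(\<lambda>x. \<bar>h x\<bar>) absolutely_integrable_on {p..q}"
    using h by (rule set_integrable_abs)
  define B where "B = (\<lambda>x. integral {p..x} (\<lambda>x. \<bar>h x\<bar>))"
  have Bc: "continuous_on {p..q} B"
    unfolding B_def by (rule indefinite_integral_continuous_1[OF h_int(2)])
  have comb: "integral {p..y} k - integral {p..x} k = integral {x..y} k"
    if "k absolutely_integrable_on {p..q}" "p \<le> x" "x \<le> y" "y \<le> q" for k :: "real \<Rightarrow> real" and x y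
    using Henstock_Kurzweil_Integration.integral_combine[of p x y k] sub[OF that(1)] that by simp
  have "bounded (f ` {p..q})"
    by (intro compact_imp_bounded compact_continuous_image[OF f]) simp
  then obtain C where "\<forall>x\<in>{p..q}. \<bar>f x\<bar> \<le> C"
    unfolding bounded_iff by auto
  then have C: "\<bar>f x\<bar> \<le> C" if "x \<in> {p..q}" for x
    using that by blast
  then have "0 \<le> C" using \<open>p \<le> q\<close> by (meson abs_ge_zero atLeastAtMost_iff order.trans order_refl)
  have Flip: "\<bar>F y - F x\<bar> \<le> C * \<bar>y - x\<bar>" if "x \<in> {p..q}" "y \<in> {p..q}" for x y
    using field_differentiable_bound[of "{p..q}" F f C y x] F C that by auto
  define \<Phi> where "\<Phi> = (\<lambda>x. integral {p..x} g - F x * w x)"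
  have main: "\<bar>\<Phi> y - \<Phi> x\<bar> \<le> 2 * C * \<bar>y - x\<bar> * \<bar>B y - B x\<bar>" if xy: "p \<le> x" "x \<le> y" "y \<le> q" for x y
  proof -
    have B1: "B y - B x = integral {x..y} (\<lambda>x. \<bar>h x\<bar>)"
      unfolding B_def by (rule comb[OF habs xy])
    have w1: "w t - w x = integral {x..t} h" if "t \<in> {x..y}" for t
      using comb[OF h, of x t] w[of x] w[of t] that xy by simp
    have B0: "0 \<le> B y - B x"
      unfolding B1 using sub[OF habs] xy by (intro integral_nonneg) auto
    have wB: "\<bar>w t - w x\<bar> \<le> B y - B x" if "t \<in> {x..y}" for t
    proof -
      have "\<bar>w t - w x\<bar> \<le> integral {x..t} (\<lambda>x. \<bar>h x\<bar>)"
        unfolding w1[OF that] using sub[OF habs] sub[OF h] xy that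
        by (intro integral_norm_bound_integral[of h, unfolded real_norm_def]) auto
      also have "\<dots> \<le> integral {x..y} (\<lambda>x. \<bar>h x\<bar>)"
        using sub[OF habs] xy that by (intro integral_subset_le) auto
      finally show ?thesis by (simp add: B1)
    qed
    have "F y - F x = integral {x..y} f"
      using xy by (intro integral_unique[symmetric] fundamental_theorem_of_calculus)
         (auto intro!: has_real_derivative_iff_has_vector_derivative[THEN iffD1] DERIV_subset[OF F])
    have fi: "f integrable_on {x..y}"
      using xy by (intro integrable_continuous_real continuous_on_subset[OF f]) auto
    have ints: "(\<lambda>t. (F t - F y) * h t) integrable_on {x..y}" "(\<lambda>t. f t * (w t - w x)) integrable_on {x..y}"
    proof -
      have "(\<lambda>t. h t * (F t - F y)) absolutely_integrable_on {p..q}"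
        by (intro absolutely_integrable_mult_continuous[OF h] continuous_intros Fc)
      from sub[OF this xy(1,3)] show "(\<lambda>t. (F t - F y) * h t) integrable_on {x..y}"
        by (simp add: mult.commute)
      have "continuous_on {p..q} (\<lambda>t. f t * (w t - w x))"
        by (intro continuous_intros f wc)
      then show "(\<lambda>t. f t * (w t - w x)) integrable_on {x..y}"
        using xy by (intro integrable_continuous_real) (auto intro: continuous_on_subset)
    qed
    \<comment> \<open>Freezing \<open>F\<close> at the right end and \<open>w\<close> at the left
      end splits the increment of the product \<open>F w\<close> exactly, so that only products of
      two small differences remain under the integral.\<close>
    have "\<Phi> y - \<Phi> x = integral {x..y} g - F y * (w y - w x) - (F y - F x) * w x"
      unfolding \<Phi>_def using comb[OF g xy] by (simp add: algebra_simps)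
    also have "\<dots> = integral {x..y} g - integral {x..y} (\<lambda>t. F y * h t) - integral {x..y} (\<lambda>t. f t * w x)"
      using w1[of y] xy \<open>F y - F x = _\<close> by simp
    also have "\<dots> = integral {x..y} (\<lambda>t. g t - F y * h t - f t * w x)"
      using sub[OF g xy(1,3)] sub[OF h xy(1,3)] fi
      by (simp add: Henstock_Kurzweil_Integration.integral_diff integrable_diff integrable_on_mult_right integrable_on_mult_left)
    also have "\<dots> = integral {x..y} (\<lambda>t. (F t - F y) * h t + f t * (w t - w x))"
      by (simp add: g_def algebra_simps)
    also have "\<dots> = integral {x..y} (\<lambda>t. (F t - F y) * h t) + integral {x..y} (\<lambda>t. f t * (w t - w x))"
      by (rule Henstock_Kurzweil_Integration.integral_add[OF ints])
    finally have eq: "\<Phi> y - \<Phi> x = \<dots>" .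
    have "\<bar>integral {x..y} (\<lambda>t. (F t - F y) * h t)\<bar> \<le> integral {x..y} (\<lambda>t. C * (y - x) * \<bar>h t\<bar>)"
    proof (rule integral_norm_bound_integral[OF ints(1), unfolded real_norm_def])
      show "(\<lambda>t. C * (y - x) * \<bar>h t\<bar>) integrable_on {x..y}"
        using sub[OF habs xy(1,3)] by (rule integrable_on_mult_right)
      show "\<bar>(F t - F y) * h t\<bar> \<le> C * (y - x) * \<bar>h t\<bar>" if "t \<in> {x..y}" for t
      proof -
        have "\<bar>F t - F y\<bar> \<le> C * \<bar>t - y\<bar>"
          using that xy by (intro Flip) auto
        also have "\<dots> \<le> C * (y - x)"
          using that \<open>0 \<le> C\<close> by (intro mult_left_mono) auto
        finally show ?thesis
          unfolding abs_mult by (rule mult_right_mono) simp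
      qed
    qed
    also have "\<dots> = C * (y - x) * (B y - B x)"
      by (simp add: B1)
    finally have 1: "\<bar>integral {x..y} (\<lambda>t. (F t - F y) * h t)\<bar> \<le> C * (y - x) * (B y - B x)" .
    have "\<bar>integral {x..y} (\<lambda>t. f t * (w t - w x))\<bar> \<le> integral {x..y} (\<lambda>t. C * (B y - B x))"
    proof (rule integral_norm_bound_integral[OF ints(2), unfolded real_norm_def])
      show "\<bar>f t * (w t - w x)\<bar> \<le> C * (B y - B x)" if "t \<in> {x..y}" for t
        unfolding abs_mult using that xy \<open>0 \<le> C\<close> by (intro mult_mono C wB) auto
    qed auto
    also have "\<dots> = C * (y - x) * (B y - B x)"
      using xy by simp
    finally have 2: "\<bar>integral {x..y} (\<lambda>t. f t * (w t - w x))\<bar> \<le> C * (y - x) * (B y - B x)" .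
    show ?thesis
      unfolding eq using 1 2 xy B0 by simp
  qed
  have main': "\<bar>\<Phi> y - \<Phi> x\<bar> \<le> 2 * C * \<bar>y - x\<bar> * \<bar>B y - B x\<bar>" if "x \<in> {p..q}" "y \<in> {p..q}" for x y
    using main[of x y] main[of y x] that by (cases "x \<le> y") (auto simp: abs_minus_commute)
  have "(\<Phi> has_real_derivative 0) (at x within {p..q})" if x: "x \<in> {p..q}" for x
  proof -
    have "(B \<longlongrightarrow> B x) (at x within {p..q})"
      using Bc x by (simp add: continuous_on_def)
    then have "((\<lambda>y. 2 * C * \<bar>B y - B x\<bar>) \<longlongrightarrow> 2 * C * \<bar>B x - B x\<bar>) (at x within {p..q})"
      by (intro tendsto_intros)
    then have "((\<lambda>y. 2 * C * \<bar>B y - B x\<bar>) \<longlongrightarrow> 0) (at x within {p..q})" by simp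
    then have "((\<lambda>y. (\<Phi> y - \<Phi> x) / (y - x)) \<longlongrightarrow> 0) (at x within {p..q})"
    proof (rule Lim_null_comparison[rotated])
      show "eventually (\<lambda>y. norm ((\<Phi> y - \<Phi> x) / (y - x)) \<le> 2 * C * \<bar>B y - B x\<bar>) (at x within {p..q})"
        unfolding eventually_at_filter
      proof (intro always_eventually allI impI)
        fix y assume "y \<noteq> x" "y \<in> {p..q}"
        then show "norm ((\<Phi> y - \<Phi> x) / (y - x)) \<le> 2 * C * \<bar>B y - B x\<bar>"
          using main'[OF x, of y] by (simp add: pos_divide_le_eq mult_ac)
      qed
    qed
    then show ?thesis by (simp add: has_field_derivative_iff)
  qed
  then obtain c where "\<And>x. x \<in> {p..q} \<Longrightarrow> \<Phi> x = c"
    using has_field_derivative_zero_constant[of "{p..q}" \<Phi>] by auto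
  then have "\<Phi> q = \<Phi> p" using \<open>p \<le> q\<close> by simp
  then show ?thesis by (simp add: \<Phi>_def g_def)
qed

subsection \<open>Regularity of weak solutions\<close>

lemma L2_space_imp_absolutely_integrable:
  assumes "f \<in> L2_space L"
  shows "f absolutely_integrable_on {0..L}"
proof -
  let ?M = "lebesgue_on {0<..<L}"
  have f: "f \<in> borel_measurable ?M" "integrable ?M (\<lambda>x. (f x)\<^sup>2)"
    using assms by (auto simp: L2_space_def)
  have "finite_measure ?M"
    by (rule finite_measure_lebesgue_on) auto
  then have "integrable ?M (\<lambda>x. 1 + (f x)\<^sup>2)"
    using f finite_measure.integrable_const by (intro Bochner_Integration.integrable_add) auto
  then have "integrable ?M f"
  proof (rule Bochner_Integration.integrable_bound)
    have "\<bar>y\<bar> \<le> 1 + y\<^sup>2" for y :: real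
    proof -
      have "0 \<le> (\<bar>y\<bar> - 1)\<^sup>2" by simp
      then have "2 * \<bar>y\<bar> \<le> 1 + y\<^sup>2" by (simp add: power2_diff)
      then show ?thesis using abs_ge_zero[of y] by linarith
    qed
    then show "AE x in ?M. norm (f x) \<le> norm (1 + (f x)\<^sup>2)"
      by (simp add: abs_of_nonneg)
  qed (rule f)
  then show ?thesis by (simp add: integrable_lebesgue_on_Ioo_iff)
qed

lemma continuous_on_imp_L2_space:
  assumes "continuous_on {0..L} f"
  shows "f \<in> L2_space L"
proof -
  have "f absolutely_integrable_on {0..L}" "(\<lambda>x. (f x)\<^sup>2) absolutely_integrable_on {0..L}"
    using assms by (auto intro!: absolutely_integrable_continuous_real continuous_intros)
  then show ?thesis
    by (simp add: L2_space_def flip: integrable_lebesgue_on_Ioo_iff)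
qed

lemma H1_with_deriv_iff:
  "H1_with_deriv L v h \<longleftrightarrow> v \<in> L2_space L \<and> h \<in> L2_space L \<and>
     (\<forall>\<phi>. test_function L \<phi> \<longrightarrow> integral {0..L} (\<lambda>x. v x * deriv \<phi> x) = - integral {0..L} (\<lambda>x. h x * \<phi> x))"
proof -
  have "(LINT x|lebesgue_on {0<..<L}. f x * \<phi> x) = integral {0..L} (\<lambda>x. f x * \<phi> x)"
    if "f \<in> L2_space L" "smooth \<phi>" for f \<phi>
    using that by (intro integral_lebesgue_on_Ioo absolutely_integrable_mult_continuous
        L2_space_imp_absolutely_integrable smooth_continuous_on)
  then have "(LINT x|lebesgue_on {0<..<L}. f x * \<phi> x) = integral {0..L} (\<lambda>x. f x * \<phi> x)"
    "(LINT x|lebesgue_on {0<..<L}. f x * deriv \<phi> x) = integral {0..L} (\<lambda>x. f x * deriv \<phi> x)"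
    if "f \<in> L2_space L" "test_function L \<phi>" for f \<phi>
    using that smooth_deriv by (simp_all add: test_function_iff)
  then show ?thesis
    by (simp add: H1_with_deriv_def cong: conj_cong imp_cong)
qed

lemma test_function_by_parts:
  assumes "L > 0" "test_function L \<phi>" "h absolutely_integrable_on {0..L}"
    and v: "\<And>x. x \<in> {0..L} \<Longrightarrow> v x = v 0 + integral {0..x} h"
  shows "integral {0..L} (\<lambda>x. v x * deriv \<phi> x) = - integral {0..L} (\<lambda>x. h x * \<phi> x)"
proof -
  have \<phi>: "smooth \<phi>" "\<phi> 0 = 0" "\<phi> L = 0"
    using assms(1,2) by (force simp: test_function_iff)+
  have hi: "h integrable_on {0..L}"
    by (rule set_lebesgue_integral_eq_integral(1)[OF assms(3)])
  have vc: "continuous_on {0..L} v"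
    using continuous_on_add[OF continuous_on_const indefinite_integral_continuous_1[OF hi], of "v 0"]
    by (rule continuous_on_eq) (rule v[symmetric])
  have i1: "(\<lambda>x. \<phi> x * h x) integrable_on {0..L}"
    using set_lebesgue_integral_eq_integral(1)[OF absolutely_integrable_mult_continuous[OF assms(3) smooth_continuous_on[OF \<phi>(1)]]]
    by (simp add: mult.commute)
  have i2: "(\<lambda>x. deriv \<phi> x * v x) integrable_on {0..L}"
    by (intro integrable_continuous_real continuous_intros vc smooth_continuous_on smooth_deriv \<phi>)
  have "integral {0..L} (\<lambda>x. \<phi> x * h x + deriv \<phi> x * v x) = \<phi> L * v L - \<phi> 0 * v 0"
    using assms(1) \<phi>(1)
    by (intro integral_by_parts_indefinite has_field_derivative_at_within[OF smooth_DERIV]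
        smooth_continuous_on smooth_deriv assms(3) v) auto
  then show ?thesis
    using Henstock_Kurzweil_Integration.integral_add[OF i1 i2] \<phi> by (simp add: mult.commute)
qed

text \<open>The supply of functions \<open>v\<close> for the weak equation. They need not vanish at
  the end points, and this freedom is what produces the boundary conditions.\<close>

lemma H1_with_deriv_C1:
  assumes "L > 0" and v: "\<And>x. x \<in> {0..L} \<Longrightarrow> (v has_real_derivative h x) (at x within {0..L})"
    and h: "continuous_on {0..L} h"
  shows "H1_with_deriv L v h"
  unfolding H1_with_deriv_iff
proof (intro conjI allI impI continuous_on_imp_L2_space h DERIV_continuous_on[OF v])
  fix \<phi> assume "test_function L \<phi>"
  then show "integral {0..L} (\<lambda>x. v x * deriv \<phi> x) = - integral {0..L} (\<lambda>x. h x * \<phi> x)"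
  proof (rule test_function_by_parts[OF \<open>L > 0\<close>])
    fix x assume x: "x \<in> {0..L}"
    have "(h has_integral v x - v 0) {0..x}"
      using x by (intro fundamental_theorem_of_calculus)
        (auto intro!: has_real_derivative_iff_has_vector_derivative[THEN iffD1] DERIV_subset[OF v])
    then show "v x = v 0 + integral {0..x} h"
      by (simp add: integral_unique)
  qed (rule absolutely_integrable_continuous_real[OF h])
qed

text \<open>Both \<open>v\<close> and the primitive of \<open>h\<close> have weak derivative
  \<open>h\<close>, so their difference has weak derivative zero and is constant almost everywhere
  by \<open>du_bois_reymond\<close>.\<close>

lemma H1_representative:
  assumes "L > 0" "H1_with_deriv L v h"
  obtains c where "negligible {x \<in> {0..L}. \<not> v x = c + integral {0..x} h}"
proof -
  have v: "v absolutely_integrable_on {0..L}" and h: "h absolutely_integrable_on {0..L}"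
    using assms(2) L2_space_imp_absolutely_integrable by (auto simp: H1_with_deriv_iff)
  define H where "H = (\<lambda>x. integral {0..x} h)"
  have "h integrable_on {0..L}"
    by (rule set_lebesgue_integral_eq_integral(1)[OF h])
  then have "continuous_on {0..L} H"
    unfolding H_def by (rule indefinite_integral_continuous_1)
  then have H: "H absolutely_integrable_on {0..L}"
    by (rule absolutely_integrable_continuous_real)
  have "\<exists>c. negligible {x \<in> {0..L}. \<not> v x - H x = c}"
  proof (rule du_bois_reymond[OF \<open>L > 0\<close>])
    show "(\<lambda>x. v x - H x) absolutely_integrable_on {0..L}"
      by (rule set_integral_diff(1)[OF v H])
  next
    fix \<phi> assume \<phi>: "test_function L \<phi>"
    then have "continuous_on {0..L} (deriv \<phi>)"
      by (intro smooth_continuous_on smooth_deriv) (simp add: test_function_iff)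
    note i = this[THEN absolutely_integrable_mult_continuous[OF v], THEN set_lebesgue_integral_eq_integral(1)]
      this[THEN absolutely_integrable_mult_continuous[OF H], THEN set_lebesgue_integral_eq_integral(1)]
    have "integral {0..L} (\<lambda>x. H x * deriv \<phi> x) = - integral {0..L} (\<lambda>x. h x * \<phi> x)"
      by (rule test_function_by_parts[OF \<open>L > 0\<close> \<phi> h]) (simp add: H_def)
    moreover have "integral {0..L} (\<lambda>x. v x * deriv \<phi> x) = - integral {0..L} (\<lambda>x. h x * \<phi> x)"
      using assms(2) \<phi> by (simp add: H1_with_deriv_iff)
    ultimately show "integral {0..L} (\<lambda>x. (v x - H x) * deriv \<phi> x) = 0"
      using Henstock_Kurzweil_Integration.integral_diff[OF i] by (simp add: left_diff_distrib)
  qed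
  then show thesis
    using that by (auto simp: H_def algebra_simps)
qed

lemma continuous_eq_if_negligible:
  fixes f g :: "real \<Rightarrow> real"
  assumes "L > 0" "continuous_on {0..L} f" "continuous_on {0..L} g"
    and "negligible {x \<in> {0..L}. \<not> f x = g x}" "x \<in> {0..L}"
  shows "f x = g x"
proof -
  have "integral {0..L} (\<lambda>x. \<bar>f x - g x\<bar>) = integral {0..L} (\<lambda>_. 0)"
    by (rule integral_spike[OF assms(4)]) auto
  then have "\<forall>x\<in>{0..L}. \<bar>f x - g x\<bar> = 0"
    using assms(1-3) by (subst (asm) integral_0, subst (asm) integral_eq_0_iff) (auto intro!: continuous_intros)
  with assms(5) show ?thesis by simp
qed

text \<open>Integrating the equation once suggests the candidate \<open>w\<close> for the
  derivative. Testing with a primitive of an arbitrary test function \<theta> shows that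
  \<open>g - w\<close> is orthogonal to \<theta>, so the weak derivative \<open>g\<close> is
  \<open>w\<close> almost everywhere. Then \<open>u\<close> is a primitive of the continuous
  \<open>w\<close>, first almost everywhere and, being continuous, everywhere.\<close>

lemma neumann_solution_classical:
  assumes L: "L > 0" and a: "a \<in> L1_space L" and sol: "neumann_solution L a u"
  obtains w where "\<And>x. x \<in> {0..L} \<Longrightarrow> (u has_real_derivative w x) (at x within {0..L})"
    and "\<And>x. x \<in> {0..L} \<Longrightarrow> w x = - integral {0..x} (\<lambda>t. a t * u t)"
    and "w L = 0"
proof -
  obtain g where uc: "continuous_on {0..L} u" and g: "H1_with_deriv L u g"
    and weak: "\<And>v h. H1_with_deriv L v h \<Longrightarrow>
       (LINT x|lebesgue_on {0<..<L}. g x * h x) = (LINT x|lebesgue_on {0<..<L}. a x * u x * v x)"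
    using sol unfolding neumann_solution_def by blast
  have ai: "a absolutely_integrable_on {0..L}"
    using a by (simp add: L1_space_def integrable_lebesgue_on_Ioo_iff)
  have au: "(\<lambda>t. a t * u t) absolutely_integrable_on {0..L}"
    by (rule absolutely_integrable_mult_continuous[OF ai uc])
  have au_int: "(\<lambda>t. a t * u t) integrable_on {0..L}"
    by (rule set_lebesgue_integral_eq_integral(1)[OF au])
  have gi: "g absolutely_integrable_on {0..L}"
    using g L2_space_imp_absolutely_integrable by (simp add: H1_with_deriv_iff)
  have g_int: "g integrable_on {0..L}"
    by (rule set_lebesgue_integral_eq_integral(1)[OF gi])
  have weak': "integral {0..L} (\<lambda>x. g x * h x) = integral {0..L} (\<lambda>x. a x * u x * v x)"
    if v: "\<And>x. x \<in> {0..L} \<Longrightarrow> (v has_real_derivative h x) (at x within {0..L})"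
      and h: "continuous_on {0..L} h" for v h
  proof -
    have "(LINT x|lebesgue_on {0<..<L}. g x * h x) = integral {0..L} (\<lambda>x. g x * h x)"
      by (intro integral_lebesgue_on_Ioo absolutely_integrable_mult_continuous gi h)
    moreover have "(LINT x|lebesgue_on {0<..<L}. a x * u x * v x) = integral {0..L} (\<lambda>x. a x * u x * v x)"
      by (intro integral_lebesgue_on_Ioo absolutely_integrable_mult_continuous[OF au] DERIV_continuous_on[OF v])
    ultimately show ?thesis
      using weak[OF H1_with_deriv_C1[OF L v h]] by simp
  qed
  define w where "w = (\<lambda>x. - integral {0..x} (\<lambda>t. a t * u t))"
  have wc: "continuous_on {0..L} w"
    unfolding w_def by (intro continuous_intros indefinite_integral_continuous_1[OF au_int])
  have wi: "w absolutely_integrable_on {0..L}"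
    by (rule absolutely_integrable_continuous_real[OF wc])
  \<comment> \<open>The constant 1 is admissible, so the integral of \<open>a u\<close> over the
    whole interval is zero.\<close>
  have wL: "w L = 0"
    using weak'[of "\<lambda>_. 1" "\<lambda>_. 0"] by (simp add: w_def)
  have gw: "negligible {x \<in> {0..L}. \<not> g x - w x = 0}"
  proof (rule fundamental_lemma_variations[OF L])
    show "(\<lambda>x. g x - w x) absolutely_integrable_on {0..L}"
      by (rule set_integral_diff(1)[OF gi wi])
  next
    fix \<theta> assume "test_function L \<theta>"
    then have \<theta>: "continuous_on {0..L} \<theta>"
      by (intro smooth_continuous_on) (simp add: test_function_iff)
    define v where "v = (\<lambda>x. integral {0..x} \<theta>)"
    have v: "(v has_real_derivative \<theta> x) (at x within {0..L})" if "x \<in> {0..L}" for x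
      unfolding v_def using \<theta> that by (rule integral_has_real_derivative)
    have vc: "continuous_on {0..L} v"
      using v by (rule DERIV_continuous_on)
    \<comment> \<open>The primitive \<open>v\<close> vanishes at 0 but in general not at
      \<open>L\<close>; the boundary term there disappears because of
      \<open>w L = 0\<close>.\<close>
    have "integral {0..L} (\<lambda>x. v x * (a x * u x) + \<theta> x * (- w x)) = v L * (- w L) - v 0 * (- w 0)"
      using L by (intro integral_by_parts_indefinite v \<theta> au) (auto simp: w_def)
    also have "\<dots> = 0"
      using wL by (simp add: v_def)
    finally have "integral {0..L} (\<lambda>x. (a x * u x) * v x - w x * \<theta> x) = 0"
      by (simp add: mult.commute)
    then have "integral {0..L} (\<lambda>x. (a x * u x) * v x) - integral {0..L} (\<lambda>x. w x * \<theta> x) = 0"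
      using Henstock_Kurzweil_Integration.integral_diff[OF
          set_lebesgue_integral_eq_integral(1)[OF absolutely_integrable_mult_continuous[OF au vc]]
          set_lebesgue_integral_eq_integral(1)[OF absolutely_integrable_mult_continuous[OF wi \<theta>]]]
      by simp
    then have "integral {0..L} (\<lambda>x. g x * \<theta> x) - integral {0..L} (\<lambda>x. w x * \<theta> x) = 0"
      using weak'[OF v \<theta>] by simp
    then show "integral {0..L} (\<lambda>x. (g x - w x) * \<theta> x) = 0"
      using Henstock_Kurzweil_Integration.integral_diff[OF
          set_lebesgue_integral_eq_integral(1)[OF absolutely_integrable_mult_continuous[OF gi \<theta>]]
          set_lebesgue_integral_eq_integral(1)[OF absolutely_integrable_mult_continuous[OF wi \<theta>]]]
      by (simp add: left_diff_distrib)
  qed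
  obtain c where c: "negligible {x \<in> {0..L}. \<not> u x = c + integral {0..x} g}"
    by (rule H1_representative[OF L g])
  have G: "integral {0..x} g = integral {0..x} w" if "x \<in> {0..L}" for x
    by (rule integral_spike[OF gw]) (use that in auto)
  have u: "u x = c + integral {0..x} w" if x: "x \<in> {0..L}" for x
  proof -
    have "u x = c + integral {0..x} g"
      by (rule continuous_eq_if_negligible[OF L uc _ c x])
        (intro continuous_intros indefinite_integral_continuous_1[OF g_int])
    then show ?thesis by (simp only: G[OF x])
  qed
  have "(u has_real_derivative w x) (at x within {0..L})" if x: "x \<in> {0..L}" for x
    unfolding has_field_derivative_def
  proof (rule has_derivative_transform[OF x u])
    show "((\<lambda>x. c + integral {0..x} w) has_derivative (*) (w x)) (at x within {0..L})"
      using DERIV_add[OF DERIV_const integral_has_real_derivative[OF wc x]]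
      by (simp add: has_field_derivative_def)
  qed
  then show thesis
  proof (rule that)
    show "w x = - integral {0..x} (\<lambda>t. a t * u t)" for x by (simp add: w_def)
  qed (simp_all add: wL)
qed

section \<open>Cosines with a prescribed number of zeros\<close>

text \<open>An arbitrary \<open>v\<close> of the Sobolev space is known only up to a null set. It is
  replaced by its absolutely continuous representative \<open>w\<close>, against which
  \<open>g\<close> can be integrated by parts; the boundary terms vanish since \<open>g\<close> does
  at both ends.\<close>

lemma neumann_solution_cos:
  fixes m :: nat
  assumes L: "L > 0"
  shows "neumann_solution L (\<lambda>_. eigval L m) (\<lambda>x. cos (real m * pi / L * x))"
proof -
  define k where "k = real m * pi / L"
  have kk: "eigval L m = k\<^sup>2"
    by (simp add: eigval_def k_def power_mult_distrib power_divide)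
  define g where "g = (\<lambda>x. - k * sin (k * x))"
  have g0: "g 0 = 0" "g L = 0"
    using L by (auto simp: g_def k_def sin_npi)
  have cosD: "((\<lambda>x. cos (k * x)) has_real_derivative g x) (at x within S)" for x S
    unfolding g_def by (auto intro!: derivative_eq_intros)
  have gD: "(g has_real_derivative - k\<^sup>2 * cos (k * x)) (at x within S)" for x S
    unfolding g_def by (auto intro!: derivative_eq_intros simp: power2_eq_square)
  have gc: "continuous_on S g" for S
    unfolding g_def by (intro continuous_intros)
  have "neumann_solution L (\<lambda>_. k\<^sup>2) (\<lambda>x. cos (k * x))"
    unfolding neumann_solution_def
  proof (intro conjI exI[of _ g] allI impI)
    show "continuous_on {0..L} (\<lambda>x. cos (k * x))" by (intro continuous_intros)
    show "H1_with_deriv L (\<lambda>x. cos (k * x)) g"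
      by (rule H1_with_deriv_C1[OF L cosD gc])
    fix v h assume vh: "H1_with_deriv L v h"
    then have h: "h absolutely_integrable_on {0..L}" and v: "v absolutely_integrable_on {0..L}"
      using L2_space_imp_absolutely_integrable by (auto simp: H1_with_deriv_iff)
    obtain c where c: "negligible {x \<in> {0..L}. \<not> v x = c + integral {0..x} h}"
      by (rule H1_representative[OF L vh])
    define w where "w = (\<lambda>x. c + integral {0..x} h)"
    have wc: "continuous_on {0..L} w"
      unfolding w_def
      by (intro continuous_intros indefinite_integral_continuous_1 set_lebesgue_integral_eq_integral(1)[OF h])
    have kv: "(\<lambda>x. v x * (k\<^sup>2 * cos (k * x))) absolutely_integrable_on {0..L}"
      by (intro absolutely_integrable_mult_continuous[OF v] continuous_intros)
    have gh: "(\<lambda>x. h x * g x) absolutely_integrable_on {0..L}"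
      by (intro absolutely_integrable_mult_continuous[OF h] gc)
    have kw: "(\<lambda>x. w x * (k\<^sup>2 * cos (k * x))) integrable_on {0..L}"
      by (intro integrable_continuous_real continuous_intros wc)
    have "integral {0..L} (\<lambda>x. g x * h x + (- k\<^sup>2 * cos (k * x)) * w x) = g L * w L - g 0 * w 0"
      using L by (intro integral_by_parts_indefinite gD h continuous_intros) (auto simp: w_def)
    then have "integral {0..L} (\<lambda>x. h x * g x - w x * (k\<^sup>2 * cos (k * x))) = 0"
      using g0 by (simp add: algebra_simps)
    then have "integral {0..L} (\<lambda>x. h x * g x) = integral {0..L} (\<lambda>x. w x * (k\<^sup>2 * cos (k * x)))"
      using Henstock_Kurzweil_Integration.integral_diff[OF set_lebesgue_integral_eq_integral(1)[OF gh] kw] by simp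
    also have "\<dots> = integral {0..L} (\<lambda>x. v x * (k\<^sup>2 * cos (k * x)))"
      by (rule integral_spike[OF c]) (auto simp: w_def)
    finally have "integral {0..L} (\<lambda>x. h x * g x) = \<dots>" .
    then have "(LINT x|lebesgue_on {0<..<L}. h x * g x) = (LINT x|lebesgue_on {0<..<L}. v x * (k\<^sup>2 * cos (k * x)))"
      by (simp only: integral_lebesgue_on_Ioo[OF gh] integral_lebesgue_on_Ioo[OF kv])
    then show "(LINT x|lebesgue_on {0<..<L}. g x * h x) =
        (LINT x|lebesgue_on {0<..<L}. k\<^sup>2 * cos (k * x) * v x)"
      by (simp add: mult.commute mult.left_commute)
  qed
  then show ?thesis by (simp add: kk k_def)
qed

lemma inner_zeros_cos:
  fixes m :: nat
  assumes L: "L > 0" and m: "m \<ge> 1"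
  shows "card (inner_zeros L (\<lambda>x. cos (real m * pi / L * x))) = m"
proof -
  \<comment> \<open>These are the points where the argument of the cosine is
    \<open>(2 * j + 1) * pi / 2\<close>.\<close>
  define z where "z = (\<lambda>j::nat. (2 * real j + 1) * L / (2 * real m))"
  have "inner_zeros L (\<lambda>x. cos (real m * pi / L * x)) = z ` {..<m}"
  proof (intro equalityI subsetI)
    fix x assume "x \<in> inner_zeros L (\<lambda>x. cos (real m * pi / L * x))"
    then have x: "0 < x" "x < L" "cos (real m * pi / L * x) = 0"
      by (auto simp: inner_zeros_def)
    then obtain i where i: "odd i" "real m * pi / L * x = of_int i * (pi / 2)"
      by (auto simp: cos_zero_iff_int)
    then obtain j where j: "i = 2 * j + 1" by (elim oddE)
    have "pi * (real m * x / L) = pi * (of_int i / 2)"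
      using i(2) by (simp add: mult_ac)
    then have "real m * x / L = of_int i / 2"
      using mult_left_cancel[OF pi_neq_zero] by blast
    then have xj: "2 * real m * x / L = 2 * of_int j + 1"
      by (simp add: j mult.commute mult.left_commute)
    \<comment> \<open>The bounds on \<open>x\<close> become bounds on an odd integer, which leave
      exactly the indices \<open>0 \<le> j < m\<close>.\<close>
    have "0 < 2 * real m * x / L" "2 * real m * x / L < 2 * real m"
      using x L m by (auto simp: field_simps)
    then have "(0::real) < 2 * of_int j + 1" "2 * of_int j + 1 < 2 * real m"
      unfolding xj by auto
    then have "0 < 2 * j + 1" "2 * j + 1 < 2 * int m"
      by linarith+
    then have "0 \<le> j" "j < int m" by auto
    moreover from this have "x = z (nat j)"
      using xj L m unfolding z_def by (simp add: field_simps)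
    ultimately show "x \<in> z ` {..<m}" by (intro image_eqI[of _ _ "nat j"]) auto
  next
    fix x assume "x \<in> z ` {..<m}"
    then obtain j where j: "j < m" "x = z j" by auto
    then have "2 * real j + 1 < 2 * real m"
      by linarith
    then have "0 < x" "x < L"
      unfolding j(2) z_def using L m by (auto simp: divide_less_eq)
    moreover have "real m * pi / L * x = of_int (2 * int j + 1) * (pi / 2)"
      unfolding j(2) z_def using L m by (simp add: field_simps)
    then have "cos (real m * pi / L * x) = 0"
      unfolding cos_zero_iff_int by (intro exI[of _ "2 * int j + 1"]) auto
    ultimately show "x \<in> inner_zeros L (\<lambda>x. cos (real m * pi / L * x))"
      by (simp add: inner_zeros_def)
  qed
  moreover have "inj_on z {..<m}"
    using L m by (auto simp: inj_on_def z_def)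
  ultimately show ?thesis by (simp add: card_image)
qed

lemma eigval_strict_mono: "L > 0 \<Longrightarrow> n < m \<Longrightarrow> eigval L n < eigval L m"
  unfolding eigval_def by (intro divide_strict_right_mono mult_strict_right_mono power_strict_mono) auto

lemma eigval_in_Lambda_set:
  assumes L: "L > 0" and nm: "n < m"
  shows "(\<lambda>_. eigval L m) \<in> Lambda_set L n"
    and "nontrivial_neumann_solution L (\<lambda>_. eigval L m) (\<lambda>x. cos (real m * pi / L * x))"
proof -
  show nt: "nontrivial_neumann_solution L (\<lambda>_. eigval L m) (\<lambda>x. cos (real m * pi / L * x))"
    unfolding nontrivial_neumann_solution_def
    using L by (intro conjI neumann_solution_cos bexI[of _ 0]) auto
  have "(\<lambda>_. eigval L m) \<in> L1_space L"
    by (simp add: L1_space_def integrable_lebesgue_on_Ioo_iff)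
  moreover have "prec_ae L (\<lambda>_. eigval L n) (\<lambda>_. eigval L m)"
  proof -
    have "{x \<in> {0..L}. eigval L n < eigval L m} = {0..L}"
      using eigval_strict_mono[OF L nm] by auto
    then show ?thesis
      using eigval_strict_mono[OF L nm] L by (simp add: prec_ae_def)
  qed
  ultimately show "(\<lambda>_. eigval L m) \<in> Lambda_set L n"
    using nt by (auto simp: Lambda_set_def)
qed

subsection \<open>Zeros of solutions and Sturm comparison\<close>

lemma constant_sign:
  fixes f :: "real \<Rightarrow> real"
  assumes "p < q" "continuous_on {p<..<q} f" "\<And>x. p < x \<Longrightarrow> x < q \<Longrightarrow> f x \<noteq> 0"
  obtains \<sigma> where "\<sigma> = 1 \<or> \<sigma> = - 1" "\<And>x. p < x \<Longrightarrow> x < q \<Longrightarrow> \<sigma> * f x > 0"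
proof -
  have conn: "connected (f ` {p<..<q})"
    by (intro connected_continuous_image assms) simp
  have same: "\<not> (f x < 0 \<and> 0 < f y)" if "x \<in> {p<..<q}" "y \<in> {p<..<q}" for x y
  proof
    assume "f x < 0 \<and> 0 < f y"
    then have "0 \<in> f ` {p<..<q}"
      using connectedD_interval[OF conn, of "f x" "f y" 0] that by simp
    then show False using assms(3) by force
  qed
  show thesis
  proof (cases "\<exists>x\<in>{p<..<q}. f x > 0")
    case True
    then have "f y > 0" if "p < y" "y < q" for y
      using same[of y] assms(3)[of y] that by force
    then show thesis by (intro that[of 1]) auto
  next
    case False
    then have "f y < 0" if "p < y" "y < q" for y
      using assms(3)[of y] that by force
    then show thesis by (intro that[of "- 1"]) auto
  qed
qed

text \<open>The classical form of the problem, with \<open>w\<close> for the derivative of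
  \<open>u\<close>. The constant \<open>lam\<close> becomes an eigenvalue only when the gaps are
  counted; the comparison itself works for any positive constant.\<close>

locale classical_neumann =
  fixes L lam :: real and a u w :: "real \<Rightarrow> real"
  assumes L_pos: "L > 0" and lam_pos: "lam > 0"
    and a_int: "a absolutely_integrable_on {0..L}"
    and a_ge: "negligible {x \<in> {0..L}. \<not> lam \<le> a x}"
    and a_gt: "\<not> negligible {x \<in> {0..L}. lam < a x}"
    and u_deriv: "x \<in> {0..L} \<Longrightarrow> (u has_real_derivative w x) (at x within {0..L})"
    and w_eq: "x \<in> {0..L} \<Longrightarrow> w x = - integral {0..x} (\<lambda>t. a t * u t)"
    and w_L: "w L = 0"
    and nontrivial: "\<exists>x\<in>{0..L}. u x \<noteq> 0"
begin

lemma w_0: "w 0 = 0"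
  using w_eq[of 0] L_pos by simp

lemma u_cont: "continuous_on {0..L} u"
  using u_deriv by (rule DERIV_continuous_on)

lemma au_int: "(\<lambda>t. a t * u t) absolutely_integrable_on {0..L}"
  by (rule absolutely_integrable_mult_continuous[OF a_int u_cont])

lemma w_diff:
  assumes "0 \<le> x" "x \<le> y" "y \<le> L"
  shows "w y - w x = - integral {x..y} (\<lambda>t. a t * u t)"
  using Henstock_Kurzweil_Integration.integral_combine[of 0 x y "\<lambda>t. a t * u t"]
    integrable_on_Icc_subset[OF au_int, of 0 y] w_eq[of x] w_eq[of y] assms by simp

lemma w_cont: "continuous_on {0..L} w"
  using continuous_on_minus[OF indefinite_integral_continuous_1[OF integrable_on_Icc_subset[OF au_int order_refl order_refl]]]
  by (rule continuous_on_eq) (rule w_eq[symmetric])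

lemma u_diff:
  assumes "0 \<le> x" "x \<le> y" "y \<le> L"
  shows "u y - u x = integral {x..y} w"
  using assms by (intro integral_unique[symmetric] fundamental_theorem_of_calculus)
    (auto intro!: has_real_derivative_iff_has_vector_derivative[THEN iffD1] DERIV_subset[OF u_deriv])

text \<open>The integrated form of the equation that is used later: \<open>F = u\<close> yields the
  energy identity, and a comparison function for \<open>F\<close> yields one half of the Wronskian
  identity.\<close>

lemma w_by_parts:
  assumes "0 \<le> p" "p \<le> q" "q \<le> L"
    and F: "\<And>x. x \<in> {p..q} \<Longrightarrow> (F has_real_derivative f x) (at x within {p..q})"
    and f: "continuous_on {p..q} f"
  shows "integral {p..q} (\<lambda>x. f x * w x) - integral {p..q} (\<lambda>x. a x * u x * F x) = F q * w q - F p * w p"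
proof -
  have au: "(\<lambda>t. a t * u t) absolutely_integrable_on {p..q}"
    by (rule absolutely_integrable_on_Icc_subset[OF au_int assms(1,3)])
  then have h: "(\<lambda>t. - (a t * u t)) absolutely_integrable_on {p..q}"
    using absolutely_integrable_mult_continuous[OF au, of "\<lambda>_. - 1"] by simp
  have "integral {p..q} (\<lambda>x. F x * (- (a x * u x)) + f x * w x) = F q * w q - F p * w p"
  proof (rule integral_by_parts_indefinite[OF \<open>p \<le> q\<close> F f h])
    show "w x = w p + integral {p..x} (\<lambda>t. - (a t * u t))" if "x \<in> {p..q}" for x
      using w_diff[of p x] that assms by simp
  qed
  moreover have "(\<lambda>x. f x * w x) integrable_on {p..q}"
    using assms by (intro integrable_continuous_real continuous_intros f continuous_on_subset[OF w_cont]) auto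
  moreover have "(\<lambda>x. a x * u x * F x) integrable_on {p..q}"
    by (intro set_lebesgue_integral_eq_integral(1)[OF absolutely_integrable_mult_continuous[OF au]]
        DERIV_continuous_on[OF F])
  ultimately show ?thesis
    using Henstock_Kurzweil_Integration.integral_diff[of "\<lambda>x. f x * w x" "{p..q}" "\<lambda>x. a x * u x * F x"]
    by (simp add: algebra_simps)
qed

lemma abs_integral_au_le: "\<bar>integral {x..y} (\<lambda>t. a t * u t)\<bar> \<le> M * integral {0..L} (\<lambda>t. \<bar>a t\<bar>)"
  if xy: "0 \<le> x" "x \<le> y" "y \<le> L" and M: "\<And>t. t \<in> {x..y} \<Longrightarrow> \<bar>u t\<bar> \<le> M"
proof -
  have aa: "(\<lambda>t. \<bar>a t\<bar>) absolutely_integrable_on {0..L}"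
    by (rule set_integrable_abs[OF a_int])
  have "0 \<le> M" using M[of x] xy by simp
  have "\<bar>integral {x..y} (\<lambda>t. a t * u t)\<bar> \<le> integral {x..y} (\<lambda>t. M * \<bar>a t\<bar>)"
  proof (rule integral_norm_bound_integral[OF integrable_on_Icc_subset[OF au_int xy(1,3)], unfolded real_norm_def])
    show "(\<lambda>t. M * \<bar>a t\<bar>) integrable_on {x..y}"
      by (intro integrable_on_mult_right integrable_on_Icc_subset[OF aa xy(1,3)])
    show "\<bar>a t * u t\<bar> \<le> M * \<bar>a t\<bar>" if "t \<in> {x..y}" for t
      using mult_right_mono[OF M[OF that], of "\<bar>a t\<bar>"] by (simp add: abs_mult mult.commute)
  qed
  also have "\<dots> = M * integral {x..y} (\<lambda>t. \<bar>a t\<bar>)" by simp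
  also have "\<dots> \<le> M * integral {0..L} (\<lambda>t. \<bar>a t\<bar>)"
    using xy \<open>0 \<le> M\<close> integrable_on_Icc_subset[OF aa] by (intro mult_left_mono integral_subset_le) auto
  finally show ?thesis .
qed

text \<open>On an interval of length at most \<open>\<delta>\<close> around a double zero the maximum \<open>M\<close> of \<open>\<bar>u\<bar>\<close> satisfies
  \<open>M \<le> \<delta> M \<parallel>a\<parallel>\<close>, and \<open>\<delta>\<close> is chosen uniformly. So the set of double zeros is open and closed.\<close>

lemma no_double_zero:
  assumes t: "t \<in> {0..L}" and zero: "u t = 0"
  shows "w t \<noteq> 0"
proof
  assume "w t = 0"
  define N where "N = integral {0..L} (\<lambda>t. \<bar>a t\<bar>)"
  have "0 \<le> N"
    unfolding N_def using absolutely_integrable_imp_abs_integrable[OF a_int] by (intro integral_nonneg) auto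
  \<comment> \<open>Any positive length with \<open>\<delta> * N < 1\<close> would do; the summand 1
    spares a case distinction on \<open>N = 0\<close>.\<close>
  define \<delta> where "\<delta> = 1 / (2 * (N + 1))"
  have \<delta>: "\<delta> > 0" "\<delta> * N < 1"
    using \<open>0 \<le> N\<close> by (auto simp: \<delta>_def field_simps)
  define D where "D = {s \<in> {0..L}. u s = 0 \<and> w s = 0}"
  have step: "r \<in> D" if s: "s \<in> D" and r: "r \<in> {0..L}" "\<bar>r - s\<bar> < \<delta>" for r s
  proof -
    define c d where "c = min r s" and "d = max r s"
    have cd: "0 \<le> c" "c \<le> d" "d \<le> L" "d - c \<le> \<delta>" "s \<in> {c..d}" "r \<in> {c..d}"
      using s r by (auto simp: c_def d_def D_def)
    have "continuous_on {c..d} (\<lambda>x. \<bar>u x\<bar>)"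
      using cd by (intro continuous_intros continuous_on_subset[OF u_cont]) auto
    then obtain x where x: "x \<in> {c..d}" and max: "\<And>y. y \<in> {c..d} \<Longrightarrow> \<bar>u y\<bar> \<le> \<bar>u x\<bar>"
      using continuous_attains_sup[of "{c..d}" "\<lambda>x. \<bar>u x\<bar>"] cd by auto
    have wb: "\<bar>w y\<bar> \<le> \<bar>u x\<bar> * N" if y: "y \<in> {c..d}" for y
    proof -
      have "w s = 0" using s by (simp add: D_def)
      show ?thesis
      proof (cases "s \<le> y")
        case True
        then show ?thesis
          using abs_integral_au_le[of s y "\<bar>u x\<bar>"] max w_diff[of s y] y cd \<open>w s = 0\<close> by (auto simp: N_def)
      next
        case False
        then show ?thesis
          using abs_integral_au_le[of y s "\<bar>u x\<bar>"] max w_diff[of y s] y cd \<open>w s = 0\<close> by (auto simp: N_def)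
      qed
    qed
    have "\<bar>u x - u s\<bar> \<le> (\<bar>u x\<bar> * N) * \<bar>x - s\<bar>"
      using field_differentiable_bound[of "{c..d}" u w "\<bar>u x\<bar> * N" x s] wb x cd
        DERIV_subset[OF u_deriv, of _ "{c..d}"] by auto
    also have "\<dots> \<le> (\<bar>u x\<bar> * N) * \<delta>"
      using x cd \<open>0 \<le> N\<close> by (intro mult_left_mono) auto
    finally have "\<bar>u x\<bar> * (1 - \<delta> * N) \<le> 0"
      using s by (simp add: D_def algebra_simps)
    then have "\<bar>u x\<bar> = 0"
      using \<delta> by (simp add: mult_le_0_iff)
    then have "u r = 0" "w r = 0"
      using max[of r] wb[of r] cd by auto
    then show ?thesis using r by (simp add: D_def)
  qed
  have op: "openin (top_of_set {0..L}) D"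
    unfolding openin_euclidean_subtopology_iff
  proof (intro conjI ballI exI[of _ \<delta>] impI)
    show "D \<subseteq> {0..L}" by (auto simp: D_def)
    show "\<delta> > 0" by (rule \<delta>)
    show "r \<in> D" if "s \<in> D" "r \<in> {0..L}" "dist r s < \<delta>" for r s
      using step[OF that(1,2)] that(3) by (simp add: dist_real_def)
  qed
  have cl: "closedin (top_of_set {0..L}) D"
  proof -
    have "D = ({0..L} \<inter> u -` {0}) \<inter> ({0..L} \<inter> w -` {0})"
      by (auto simp: D_def)
    then show ?thesis
      using continuous_closedin_preimage[OF u_cont, of "{0}"] continuous_closedin_preimage[OF w_cont, of "{0}"]
      by (simp add: closedin_Int)
  qed
  have "D = {} \<or> D = {0..L}"
    using connected_clopen[of "{0..L}"] op cl by auto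
  moreover have "t \<in> D"
    using t zero \<open>w t = 0\<close> by (simp add: D_def)
  ultimately have "D = {0..L}" by blast
  then show False using nontrivial by (auto simp: D_def)
qed

lemma deriv_zeros_eq: "deriv_zeros L u = {t \<in> {0..L}. w t = 0}"
proof -
  have "w t = 0" if "t \<in> {0..L}" "(u has_real_derivative 0) (at t within {0..L})" for t
    using vector_derivative_unique_within_closed_interval[of 0 L t u "w t" 0] that L_pos u_deriv[OF that(1)]
    by (simp add: has_real_derivative_iff_has_vector_derivative)
  moreover have "(u has_real_derivative 0) (at t within {0..L})" if "t \<in> {0..L}" "w t = 0" for t
    using u_deriv[OF that(1)] that(2) by simp
  ultimately show ?thesis
    unfolding deriv_zeros_def by blast
qed

text \<open>At an accumulation point of zeros \<open>u\<close> vanishes by continuity, and its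
  difference quotients vanish along the zeros. That would be a double zero.\<close>

lemma finite_inner_zeros: "finite (inner_zeros L u)"
proof (rule ccontr)
  assume inf: "infinite (inner_zeros L u)"
  have "inner_zeros L u \<subseteq> {0..L}" by (auto simp: inner_zeros_def)
  with inf obtain l where l: "l \<in> {0..L}" "l islimpt inner_zeros L u"
    using compact_eq_Bolzano_Weierstrass[of "{0..L}"] by auto
  let ?S = "{x \<in> {0..L}. u x = 0}"
  have "closed ?S"
    using continuous_closed_preimage_constant[OF u_cont, of 0] by simp
  moreover have "l islimpt ?S"
    using l(2) by (rule islimpt_subset) (auto simp: inner_zeros_def)
  ultimately have "u l = 0"
    using closed_limpt by blast
  then have "w l \<noteq> 0" by (rule no_double_zero[OF l(1)])
  have "((\<lambda>y. (u y - u l) / (y - l)) \<longlongrightarrow> w l) (at l within {0..L})"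
    using u_deriv[OF l(1)] by (simp add: has_field_derivative_iff)
  then have "eventually (\<lambda>y. (u y - u l) / (y - l) \<noteq> 0) (at l within {0..L})"
    using \<open>w l \<noteq> 0\<close> by (rule tendsto_imp_eventually_ne)
  then have "eventually (\<lambda>y. y \<notin> ?S) (at l)"
    unfolding eventually_at_filter by (rule eventually_mono) (simp add: \<open>u l = 0\<close>)
  with \<open>l islimpt ?S\<close> show False
    by (simp add: islimpt_iff_eventually)
qed

text \<open>Where \<open>u\<close> has sign \<sigma>, the density of \<open>\<sigma> * w\<close> is
  \<open>- a * (\<sigma> * u)\<close>, almost everywhere at most
  \<open>- lam * (\<sigma> * u)\<close>, and the latter has negative integral because
  \<open>lam > 0\<close>. In other words, the absolute value of \<open>u\<close> is strictly concave
  between zeros.\<close>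

lemma w_decreasing:
  assumes "0 \<le> p" "q \<le> L" and pos: "\<And>x. p < x \<Longrightarrow> x < q \<Longrightarrow> \<sigma> * u x > 0"
    and xy: "p \<le> x" "x < y" "y \<le> q"
  shows "\<sigma> * w y < \<sigma> * w x"
proof -
  have sub: "{x..y} \<subseteq> {0..L}" using assms by auto
  have cont: "continuous_on {x..y} (\<lambda>t. \<sigma> * u t)"
    by (intro continuous_intros continuous_on_subset[OF u_cont sub])
  have nonneg: "0 \<le> \<sigma> * u t" if "t \<in> {x..y}" for t
  proof (rule continuous_ge_on_closure[of "{x<..<y}" "\<lambda>t. \<sigma> * u t"])
    show "continuous_on (closure {x<..<y}) (\<lambda>t. \<sigma> * u t)" using cont xy by simp
    show "t \<in> closure {x<..<y}" using that xy by simp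
    show "0 \<le> \<sigma> * u t" if "t \<in> {x<..<y}" for t using pos[of t] that xy by simp
  qed
  have "integral {x..y} (\<lambda>t. \<sigma> * u t) \<noteq> 0"
  proof
    assume "integral {x..y} (\<lambda>t. \<sigma> * u t) = 0"
    then have "\<sigma> * u ((x + y) / 2) = 0"
      using integral_eq_0_iff[OF cont xy(2) nonneg] xy by auto
    then show False
      using pos[of "(x + y) / 2"] xy by auto
  qed
  moreover have "0 \<le> integral {x..y} (\<lambda>t. \<sigma> * u t)"
    by (intro integral_nonneg integrable_continuous_real cont nonneg)
  ultimately have "0 < integral {x..y} (\<lambda>t. \<sigma> * u t)"
    by (simp only: less_le) simp
  then have "0 < lam * integral {x..y} (\<lambda>t. \<sigma> * u t)"
    using lam_pos by (rule mult_pos_pos[rotated])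
  also have "\<dots> = integral {x..y} (\<lambda>t. lam * (\<sigma> * u t))" by simp
  also have "\<dots> \<le> integral {x..y} (\<lambda>t. \<sigma> * (a t * u t))"
  proof (rule integral_le_ae[OF _ _ a_ge])
    show "(\<lambda>t. lam * (\<sigma> * u t)) integrable_on {x..y}"
      by (intro integrable_continuous_real continuous_intros cont)
    show "(\<lambda>t. \<sigma> * (a t * u t)) integrable_on {x..y}"
      using assms by (intro integrable_on_mult_right integrable_on_Icc_subset[OF au_int]) auto
    show "lam * (\<sigma> * u t) \<le> \<sigma> * (a t * u t)" if "t \<in> {x..y} - {x \<in> {0..L}. \<not> lam \<le> a x}" for t
      using mult_right_mono[OF _ nonneg[of t], of lam "a t"] that sub by (auto simp: algebra_simps)
  qed
  also have "\<dots> = \<sigma> * integral {x..y} (\<lambda>t. a t * u t)" by simp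
  also have "integral {x..y} (\<lambda>t. a t * u t) = w x - w y"
    using w_diff[of x y] assms by simp
  finally show ?thesis by (simp add: right_diff_distrib)
qed

lemma sign_between_zeros:
  assumes "0 \<le> p" "p < q" "q \<le> L" "\<And>x. p < x \<Longrightarrow> x < q \<Longrightarrow> u x \<noteq> 0"
  shows "\<exists>\<sigma>. (\<sigma> = 1 \<or> \<sigma> = - 1) \<and> (\<forall>x. p < x \<longrightarrow> x < q \<longrightarrow> \<sigma> * u x > 0)"
proof -
  have "continuous_on {p<..<q} u"
    using assms by (intro continuous_on_subset[OF u_cont]) auto
  from constant_sign[OF assms(2) this assms(4)] show ?thesis by blast
qed

text \<open>Without an inner zero \<open>w\<close> would be strictly monotone on
  \<open>[0,L]\<close>, although it is 0 at both ends.\<close>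

lemma inner_zeros_nonempty: "inner_zeros L u \<noteq> {}"
proof
  assume none: "inner_zeros L u = {}"
  then have nz: "u x \<noteq> 0" if "0 < x" "x < L" for x
    using that by (auto simp: inner_zeros_def)
  obtain \<sigma> where "\<forall>x. 0 < x \<longrightarrow> x < L \<longrightarrow> \<sigma> * u x > 0"
    using sign_between_zeros[OF order_refl L_pos order_refl nz] by blast
  then have "\<sigma> * u x > 0" if "0 < x" "x < L" for x
    using that by blast
  from w_decreasing[OF order_refl order_refl this order_refl L_pos order_refl] show False
    by (simp add: w_0 w_L)
qed

text \<open>Existence comes from the boundary condition if the interval touches 0 or
  \<open>L\<close>, and from Rolle's theorem otherwise. Uniqueness is strict monotonicity of
  \<open>w\<close>. At an end where \<open>u\<close> vanishes the critical point cannot lie, since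
  that would be a double zero.\<close>

lemma critical_point_between_zeros:
  assumes "0 \<le> p" "p < q" "q \<le> L" and nz: "\<And>x. p < x \<Longrightarrow> x < q \<Longrightarrow> u x \<noteq> 0"
    and p: "p = 0 \<or> u p = 0" and q: "q = L \<or> u q = 0"
  shows "\<exists>t. p \<le> t \<and> t \<le> q \<and> w t = 0 \<and> (\<forall>s. p \<le> s \<longrightarrow> s \<le> q \<longrightarrow> w s = 0 \<longrightarrow> s = t) \<and>
    (p = 0 \<longrightarrow> t = 0) \<and> (q = L \<longrightarrow> t = L) \<and> (p \<noteq> 0 \<longrightarrow> p < t) \<and> (q \<noteq> L \<longrightarrow> t < q)"
proof -
  obtain \<sigma> where "\<forall>x. p < x \<longrightarrow> x < q \<longrightarrow> \<sigma> * u x > 0"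
    using sign_between_zeros[OF assms(1-3) nz] by blast
  then have \<sigma>: "\<sigma> * u x > 0" if "p < x" "x < q" for x
    using that by blast
  have uniq: "s = t" if "p \<le> s" "s \<le> q" "w s = 0" "p \<le> t" "t \<le> q" "w t = 0" for s t
    using w_decreasing[OF assms(1,3) \<sigma>, of s t] w_decreasing[OF assms(1,3) \<sigma>, of t s] that
    by (cases s t rule: linorder_cases) auto
  have ends: "u r = 0 \<Longrightarrow> w r \<noteq> 0" if "p \<le> r" "r \<le> q" for r
    using no_double_zero[of r] that assms by simp
  have "\<exists>t. p \<le> t \<and> t \<le> q \<and> w t = 0"
  proof (cases "p = 0 \<or> q = L")
    case True
    then show ?thesis
      using w_0 w_L assms(2) by (metis order_less_imp_le order_refl)
  next
    case False
    have cont: "continuous_on {p..q} u"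
      using assms by (intro continuous_on_subset[OF u_cont]) auto
    obtain t where t: "p < t" "t < q" "(\<lambda>v. w t * v) = (\<lambda>v. 0)"
    proof -
      have "(u has_derivative (\<lambda>v. w x * v)) (at x)" if "p < x" "x < q" for x
        using u_deriv[of x] that assms by (simp add: has_field_derivative_def at_within_Icc_at)
      then show thesis
        using Rolle_deriv[OF \<open>p < q\<close> _ cont, of "\<lambda>x v. w x * v"] p q False that by auto
    qed
    then have "w t = 0" by (metis mult.right_neutral)
    with t show ?thesis by (intro exI[of _ t]) auto
  qed
  then obtain t where t: "p \<le> t" "t \<le> q" "w t = 0" by blast
  have "p = 0 \<Longrightarrow> t = 0" "q = L \<Longrightarrow> t = L"
    using uniq[OF t, of p] uniq[OF t, of q] w_0 w_L assms by auto
  moreover have "p \<noteq> 0 \<Longrightarrow> p < t" "q \<noteq> L \<Longrightarrow> t < q"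
    using p q ends[of p] ends[of q] t assms by (auto simp: less_le)
  ultimately show ?thesis
    using t uniq by blast
qed

section \<open>Enumerating the interlacing zeros\<close>

text \<open>The \<open>m\<close> inner zeros cut \<open>[0,L]\<close> into \<open>m + 1\<close>
  cells, each with exactly one critical point. Even indices enumerate these points
  \<open>d k\<close>, odd indices the zeros \<open>z k\<close> separating the cells.\<close>

lemma zeros_enum_exists: "\<exists>m x. zeros_enum L u m x"
proof -
  let ?Z = "inner_zeros L u"
  define m where "m = card ?Z"
  define z where "z = (\<lambda>i. sorted_list_of_set ?Z ! i)"
  have len: "length (sorted_list_of_set ?Z) = m"
    by (simp add: m_def)
  have Z: "?Z = z ` {..<m}"
    using set_sorted_list_of_set[OF finite_inner_zeros] len
    by (auto simp: z_def set_conv_nth)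
  have z_mono: "z i < z j" if "i < j" "j < m" for i j
    using sorted_wrt_nth_less[OF strict_sorted_list_of_set, of i j ?Z] that len by (simp add: z_def)
  have z_le: "z i \<le> z j" if "i \<le> j" "j < m" for i j
    using z_mono[of i j] that by (cases "i = j") auto
  have m_pos: "m > 0"
    using inner_zeros_nonempty finite_inner_zeros by (simp add: m_def card_gt_0_iff)
  have z_in: "0 < z i \<and> z i < L \<and> u (z i) = 0" if "i < m" for i
    using Z that by (auto simp: inner_zeros_def)
  \<comment> \<open>The left end \<open>l k\<close> and the right end \<open>r k\<close> of cell
    number \<open>k\<close>, for \<open>k \<le> m\<close>; neighbouring cells share a zero,
    \<open>r (k - 1) = l k\<close>.\<close>
  define l where "l = (\<lambda>k::nat. if k = 0 then 0 else z (k - 1))"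
  define r where "r = (\<lambda>k::nat. if k = m then L else z k)"
  have l: "0 \<le> l k" "l k < L" "l k = 0 \<or> u (l k) = 0" "l k = 0 \<longleftrightarrow> k = 0" if "k \<le> m" for k
  proof -
    have "k \<noteq> 0 \<Longrightarrow> k - 1 < m" using that by simp
    then show "0 \<le> l k" "l k < L" "l k = 0 \<or> u (l k) = 0" "l k = 0 \<longleftrightarrow> k = 0"
      using z_in[of "k - 1"] L_pos by (cases "k = 0"; simp add: l_def)+
  qed
  have r: "0 < r k" "r k \<le> L" "r k = L \<or> u (r k) = 0" "r k = L \<longleftrightarrow> k = m" if "k \<le> m" for k
    using z_in[of k] L_pos that by (cases "k = m"; simp add: r_def)+
  have lr: "l k < r k" if "k \<le> m" for k
    using l[OF that] r[OF that] z_mono[of "k - 1" k] that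
    by (cases "k = 0"; cases "k = m"; simp add: l_def r_def)
  have nz: "u x \<noteq> 0" if k: "k \<le> m" and x: "l k < x" "x < r k" for k x
  proof
    assume "u x = 0"
    then have "x \<in> z ` {..<m}"
      using l(1)[OF k] r(2)[OF k] x unfolding Z[symmetric] by (auto simp: inner_zeros_def)
    then obtain j where j: "j < m" "x = z j" by auto
    show False
    proof (cases "j < k")
      case True
      then have "z j \<le> z (k - 1)"
        using z_le[of j "k - 1"] k by simp
      then show False using x j True by (simp add: l_def)
    next
      case False
      then have "z k \<le> z j" "k \<noteq> m"
        using z_le[of k j] j by auto
      then show False using x j by (simp add: r_def)
    qed
  qed
  \<comment> \<open>The clauses on end points are expressed through the index: by
    \<open>l(4)\<close> and \<open>r(4)\<close>, only cell 0 starts at 0 and only cell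
    \<open>m\<close> ends at \<open>L\<close>.\<close>
  define P where "P = (\<lambda>k t. l k \<le> t \<and> t \<le> r k \<and> w t = 0 \<and> (\<forall>s. l k \<le> s \<longrightarrow> s \<le> r k \<longrightarrow> w s = 0 \<longrightarrow> s = t) \<and>
      (k = 0 \<longrightarrow> t = 0) \<and> (k = m \<longrightarrow> t = L) \<and> (k \<noteq> 0 \<longrightarrow> l k < t) \<and> (k \<noteq> m \<longrightarrow> t < r k))"
  define d where "d = (\<lambda>k. SOME t. P k t)"
  have "P k (d k)" if k: "k \<le> m" for k
    unfolding d_def
  proof (rule someI_ex)
    show "\<exists>t. P k t"
      using critical_point_between_zeros[OF l(1)[OF k] lr[OF k] r(2)[OF k] nz[OF k] l(3)[OF k] r(3)[OF k]]
      unfolding P_def l(4)[OF k] r(4)[OF k] .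
  qed
  then have d: "l k \<le> d k \<and> d k \<le> r k \<and> w (d k) = 0 \<and> (k = 0 \<longrightarrow> d k = 0) \<and>
       (k = m \<longrightarrow> d k = L) \<and> (k \<noteq> 0 \<longrightarrow> l k < d k) \<and> (k \<noteq> m \<longrightarrow> d k < r k)"
    and d_unique: "\<And>s. l k \<le> s \<Longrightarrow> s \<le> r k \<Longrightarrow> w s = 0 \<Longrightarrow> s = d k" if "k \<le> m" for k
    using that unfolding P_def by blast+
  define x where "x = (\<lambda>i::nat. if even i then d (i div 2) else z (i div 2))"
  have x_simps: "x (2 * k) = d k" "x (2 * k + 1) = z k" for k
    by (simp_all add: x_def)
  have step: "x i < x (Suc i)" if i: "i < 2 * m" for i
  proof (cases "even i")
    case True
    then obtain k where "i = 2 * k" by (elim evenE)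
    then show ?thesis
      using i d[of k] x_simps[of k] by (simp add: r_def)
  next
    case False
    then obtain k where k: "i = 2 * k + 1" by (elim oddE)
    then show ?thesis
      using i d[of "Suc k"] x_simps(1)[of "Suc k"] x_simps(2)[of k] by (simp add: l_def)
  qed
  have mono: "x i < x j" if "i < j" "j \<le> 2 * m" for i j
    using that
  proof (induction j)
    case (Suc j)
    then show ?case
      using step[of j] by (cases "i = j") (auto intro: less_trans)
  qed simp
  have "{t \<in> {0..L}. w t = 0} = {d k |k. k \<le> m}"
  proof (intro equalityI subsetI)
    fix t assume t: "t \<in> {t \<in> {0..L}. w t = 0}"
    \<comment> \<open>The first cell not entirely to the left of \<open>t\<close>. By minimality
      \<open>t\<close> lies beyond \<open>r (k - 1)\<close>, which is the left end
      \<open>l k\<close>.\<close>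
    define k where "k = (LEAST k. t \<le> r k)"
    have "t \<le> r m" using t by (simp add: r_def)
    then have k: "t \<le> r k" "k \<le> m"
      unfolding k_def by (rule LeastI, intro Least_le)
    moreover have "l k \<le> t"
    proof (cases "k = 0")
      case True
      then show ?thesis using t by (simp add: l_def)
    next
      case False
      then have "\<not> t \<le> r (k - 1)"
        unfolding k_def by (intro not_less_Least) simp
      then show ?thesis using False k by (simp add: l_def r_def split: if_splits)
    qed
    ultimately have "t = d k" using t by (intro d_unique) auto
    with k show "t \<in> {d k |k. k \<le> m}" by blast
  next
    fix t assume "t \<in> {d k |k. k \<le> m}"
    then obtain k where "k \<le> m" "t = d k" by blast
    then show "t \<in> {t \<in> {0..L}. w t = 0}"
      using d[of k] l(1)[of k] r(2)[of k] by auto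
  qed
  then have "zeros_enum L u m x"
    unfolding zeros_enum_def deriv_zeros_eq x_simps
    using d[of 0] d[of m] x_simps(1)[of 0] mono Z by (auto simp: strict_mono_on_def)
  then show ?thesis by blast
qed

section \<open>Comparison with the constant coefficient\<close>

text \<open>The integrated form of \<open>(w T - u T')' = - (a - lam) u T\<close>. Two partial
  integrations, one for \<open>w T\<close> and one for \<open>u T'\<close>, are subtracted so that
  the mixed term \<open>w T'\<close> cancels.\<close>

lemma wronskian:
  assumes pq: "0 \<le> p" "p \<le> q" "q \<le> L"
    and T: "\<And>x. (T has_real_derivative T' x) (at x)" "\<And>x. (T' has_real_derivative - lam * T x) (at x)"
  shows "integral {p..q} (\<lambda>x. (a x - lam) * (u x * T x)) =
           (w p * T p - u p * T' p) - (w q * T q - u q * T' q)"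
proof -
  have Tc: "continuous_on S T" "continuous_on S T'" for S
    by (rule DERIV_continuous_on[OF has_field_derivative_at_within[OF T(1)]],
        rule DERIV_continuous_on[OF has_field_derivative_at_within[OF T(2)]])
  have uD: "(u has_real_derivative w x) (at x within {p..q})" if "x \<in> {p..q}" for x
    using that pq by (intro DERIV_subset[OF u_deriv]) auto
  have uc: "continuous_on {p..q} u" and wc: "continuous_on {p..q} w"
    using pq by (auto intro: continuous_on_subset[OF u_cont] continuous_on_subset[OF w_cont])
  have 1: "integral {p..q} (\<lambda>x. T' x * w x) - integral {p..q} (\<lambda>x. a x * u x * T x) = T q * w q - T p * w p"
    using pq by (intro w_by_parts has_field_derivative_at_within[OF T(1)] Tc)
  have "((\<lambda>x. w x * T' x - lam * (u x * T x)) has_integral u q * T' q - u p * T' p) {p..q}"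
  proof (rule fundamental_theorem_of_calculus[OF pq(2)])
    fix x assume "x \<in> {p..q}"
    from DERIV_mult[OF uD[OF this] has_field_derivative_at_within[OF T(2)]]
    show "((\<lambda>x. u x * T' x) has_vector_derivative w x * T' x - lam * (u x * T x)) (at x within {p..q})"
      by (simp add: has_real_derivative_iff_has_vector_derivative algebra_simps)
  qed
  then have "integral {p..q} (\<lambda>x. w x * T' x - lam * (u x * T x)) = u q * T' q - u p * T' p"
    by (rule integral_unique)
  moreover have i2: "(\<lambda>x. w x * T' x) integrable_on {p..q}" "(\<lambda>x. lam * (u x * T x)) integrable_on {p..q}"
    by (intro integrable_continuous_real continuous_intros uc wc Tc)+
  ultimately have 2: "integral {p..q} (\<lambda>x. T' x * w x) - integral {p..q} (\<lambda>x. lam * (u x * T x)) = u q * T' q - u p * T' p"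
    using Henstock_Kurzweil_Integration.integral_diff[OF i2] by (simp add: mult.commute)
  have "(\<lambda>x. a x * u x * T x) integrable_on {p..q}"
    by (rule set_lebesgue_integral_eq_integral(1)[OF absolutely_integrable_mult_continuous[OF
          absolutely_integrable_on_Icc_subset[OF au_int pq(1,3)] Tc(1)]])
  from Henstock_Kurzweil_Integration.integral_diff[OF this i2(2)]
  have "integral {p..q} (\<lambda>x. (a x - lam) * (u x * T x)) =
      integral {p..q} (\<lambda>x. a x * u x * T x) - integral {p..q} (\<lambda>x. lam * (u x * T x))"
    by (simp add: algebra_simps)
  with 1 2 show ?thesis by (simp add: algebra_simps)
qed

text \<open>The integrand of the Wronskian identity, times \<sigma>, is nonnegative almost
  everywhere, so the boundary expression cannot be negative. If it is also at most 0, the integrand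
  is zero almost everywhere, and since \<open>u T\<close> has no zero inside, \<open>a = lam\<close>
  follows.\<close>

lemma comparison:
  assumes pq: "0 \<le> p" "p \<le> q" "q \<le> L"
    and T: "\<And>x. (T has_real_derivative T' x) (at x)" "\<And>x. (T' has_real_derivative - lam * T x) (at x)"
    and pos: "\<And>x. p < x \<Longrightarrow> x < q \<Longrightarrow> \<sigma> * (u x * T x) > 0"
    and le: "\<sigma> * ((w p * T p - u p * T' p) - (w q * T q - u q * T' q)) \<le> 0"
  shows "\<sigma> * ((w p * T p - u p * T' p) - (w q * T q - u q * T' q)) = 0"
    and "negligible {x \<in> {p..q}. \<not> a x = lam}"
proof -
  let ?N = "{x \<in> {0..L}. \<not> lam \<le> a x} \<union> {p, q}"
  have N: "negligible ?N"
    using a_ge by (intro negligible_Un) auto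
  have Tc: "continuous_on S T" for S
    by (rule DERIV_continuous_on[OF has_field_derivative_at_within[OF T(1)]])
  define f where "f = (\<lambda>x. \<sigma> * ((a x - lam) * (u x * T x)))"
  have "(\<lambda>x. a x - lam) absolutely_integrable_on {p..q}"
    by (rule set_integral_diff(1)[OF absolutely_integrable_on_Icc_subset[OF a_int pq(1,3)] absolutely_integrable_on_const]) simp
  then have "(\<lambda>x. (a x - lam) * (u x * T x)) absolutely_integrable_on {p..q}"
    using pq by (intro absolutely_integrable_mult_continuous continuous_intros Tc continuous_on_subset[OF u_cont]) auto
  then have f_int: "f integrable_on {p..q}"
    unfolding f_def by (intro integrable_on_mult_right) (rule set_lebesgue_integral_eq_integral(1))
  have f_eq: "integral {p..q} f = \<sigma> * ((w p * T p - u p * T' p) - (w q * T q - u q * T' q))"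
    unfolding f_def using wronskian[OF pq T] by simp
  have fx: "f x = (a x - lam) * (\<sigma> * (u x * T x))" for x
    by (simp add: f_def)
  have nonneg: "0 \<le> f x" if "x \<in> {p..q} - ?N" for x
  proof -
    have "0 \<le> a x - lam" "0 \<le> \<sigma> * (u x * T x)"
      using that pos[of x] pq by auto
    then show ?thesis
      unfolding fx by (rule mult_nonneg_nonneg)
  qed
  then have "integral {p..q} (\<lambda>_. 0) \<le> integral {p..q} f"
    by (intro integral_le_ae[OF _ f_int N]) auto
  with le f_eq show 0: "\<sigma> * ((w p * T p - u p * T' p) - (w q * T q - u q * T' q)) = 0"
    by simp
  have "negligible {x \<in> {p..q}. \<not> 0 \<le> f x}"
    using nonneg by (intro negligible_subset[OF N]) auto
  from negligible_nonzero_if_integral_nonneg_0[OF f_int this] f_eq 0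
  have "negligible {x \<in> {p..q}. \<not> f x = 0}" by simp
  with N have "negligible ({x \<in> {p..q}. \<not> f x = 0} \<union> ?N)"
    by (rule negligible_Un[rotated])
  then show "negligible {x \<in> {p..q}. \<not> a x = lam}"
  proof (rule negligible_subset)
    have "f x \<noteq> 0" if "x \<in> {p..q}" "a x \<noteq> lam" "x \<noteq> p" "x \<noteq> q" for x
    proof -
      have "p < x" "x < q" using that by auto
      then have "\<sigma> * (u x * T x) \<noteq> 0"
        by (rule less_imp_neq[OF pos, symmetric])
      then show ?thesis
        unfolding fx using that(2) by (intro no_zero_divisors) auto
    qed
    then show "{x \<in> {p..q}. \<not> a x = lam} \<subseteq> {x \<in> {p..q}. \<not> f x = 0} \<union> ?N" by blast
  qed
qed

text \<open>Assuming the gap to be long gives the bound and the case of equality at once. The cosine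
  centred at the critical end has its first zero \<open>y\<close> at distance
  \<open>pi / (2 * k)\<close>, hence inside the gap or at its other end. The comparison forces
  \<open>u y = 0\<close>, so \<open>y\<close> is the other end.\<close>

lemma gap:
  assumes pq: "0 \<le> p" "p < q" "q \<le> L" and nz: "\<And>x. p < x \<Longrightarrow> x < q \<Longrightarrow> u x \<noteq> 0"
    and ends: "w p = 0 \<and> u q = 0 \<or> u p = 0 \<and> w q = 0"
    and k: "k > 0" "k\<^sup>2 = lam"
    and long: "pi / (2 * k) \<le> q - p"
  shows "q - p = pi / (2 * k)" and "negligible {x \<in> {p..q}. \<not> a x = lam}"
proof -
  obtain \<sigma> where "(\<sigma> = 1 \<or> \<sigma> = - 1) \<and> (\<forall>x. p < x \<longrightarrow> x < q \<longrightarrow> \<sigma> * u x > 0)"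
    using sign_between_zeros[OF pq nz] by blast
  then have \<sigma>: "\<sigma> = 1 \<or> \<sigma> = - 1" "p < x \<Longrightarrow> x < q \<Longrightarrow> \<sigma> * u x > 0" for x
    by blast+
  have half: "k * (pi / (2 * k)) = pi / 2" and len_pos: "pi / (2 * k) > 0"
    using k by auto
  have D: "((\<lambda>x. cos (k * (x - e))) has_real_derivative - k * sin (k * (x - e))) (at x)"
    "((\<lambda>x. - k * sin (k * (x - e))) has_real_derivative - lam * cos (k * (x - e))) (at x)" for x e
    unfolding k(2)[symmetric] by (auto intro!: derivative_eq_intros simp: power2_eq_square)
  have cos_pos: "cos (k * y) > 0" if "\<bar>y\<bar> < pi / (2 * k)" for y
  proof -
    have "\<bar>k * y\<bar> < pi / 2"
      using mult_strict_left_mono[OF that k(1)] k(1) by (simp add: abs_mult half)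
    then show ?thesis by (intro cos_gt_zero_pi) auto
  qed
  have sgn: "\<sigma> * u x \<ge> 0" if "p \<le> x" "x \<le> q" for x
  proof (rule continuous_ge_on_closure[of "{p<..<q}" "\<lambda>x. \<sigma> * u x"])
    show "continuous_on (closure {p<..<q}) (\<lambda>x. \<sigma> * u x)"
      using pq by (intro continuous_intros continuous_on_subset[OF u_cont]) auto
  qed (use that pq \<sigma>(2) in \<open>auto intro: less_imp_le\<close>)
  have "q - p = pi / (2 * k) \<and> negligible {x \<in> {p..q}. \<not> a x = lam}"
    using ends
  proof
    assume e: "w p = 0 \<and> u q = 0"
    define y where "y = p + pi / (2 * k)"
    have y: "p < y" "y \<le> q" "y - p = pi / (2 * k)"
      using long len_pos by (auto simp: y_def)
    have pos: "\<sigma> * (u x * cos (k * (x - p))) > 0" if "p < x" "x < y" for x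
      using mult_pos_pos[OF \<sigma>(2)[of x] cos_pos[of "x - p"]] that y by (simp add: mult.assoc)
    have cs: "cos (k * (y - p)) = 0" "sin (k * (y - p)) = 1"
      unfolding y(3) half by auto
    \<comment> \<open>At the critical end \<open>w\<close> and the derivative of the cosine vanish;
      at \<open>y\<close> the cosine does. Only a term in \<open>u y\<close> survives, and its sign
      is the one that \<open>comparison\<close> requires.\<close>
    have B: "\<sigma> * ((w p * cos (k * (p - p)) - u p * (- k * sin (k * (p - p)))) -
          (w y * cos (k * (y - p)) - u y * (- k * sin (k * (y - p))))) = - (k * (\<sigma> * u y))"
      using e by (simp add: cs)
    have le: "- (k * (\<sigma> * u y)) \<le> 0"
      using k sgn[of y] y by simp
    note c = comparison[OF pq(1) less_imp_le[OF y(1)] order.trans[OF y(2) pq(3)] D pos le[folded B], unfolded B]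
    from c(1) k \<sigma>(1) have "u y = 0" by auto
    then have "y = q" using nz[of y] y by force
    with c(2) y show ?thesis by simp
  next
    assume e: "u p = 0 \<and> w q = 0"
    define y where "y = q - pi / (2 * k)"
    have y: "p \<le> y" "y < q" "y - q = - (pi / (2 * k))"
      using long len_pos by (auto simp: y_def)
    have pos: "\<sigma> * (u x * cos (k * (x - q))) > 0" if "y < x" "x < q" for x
      using mult_pos_pos[OF \<sigma>(2)[of x] cos_pos[of "x - q"]] that y by (simp add: mult.assoc)
    have cs: "cos (k * (y - q)) = 0" "sin (k * (y - q)) = - 1"
      unfolding y(3) mult_minus_right half by auto
    have B: "\<sigma> * ((w y * cos (k * (y - q)) - u y * (- k * sin (k * (y - q)))) -
          (w q * cos (k * (q - q)) - u q * (- k * sin (k * (q - q))))) = - (k * (\<sigma> * u y))"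
      using e by (simp add: cs)
    have le: "- (k * (\<sigma> * u y)) \<le> 0"
      using k sgn[of y] y by simp
    note c = comparison[OF order.trans[OF pq(1) y(1)] less_imp_le[OF y(2)] pq(3) D pos le[folded B], unfolded B]
    from c(1) k \<sigma>(1) have "u y = 0" by auto
    then have "y = p" using nz[of y] y by force
    with c(2) y show ?thesis by simp
  qed
  then show "q - p = pi / (2 * k)" "negligible {x \<in> {p..q}. \<not> a x = lam}" by auto
qed

text \<open>The point \<open>d\<close> is the critical end of the gap, left or right, and treats
  both parities at once. Since \<open>w\<close> vanishes there and \<open>\<sigma> * w\<close>
  decreases, the absolute value of \<open>u\<close> is largest at \<open>d\<close>; it is nonzero
  there because there are no double zeros.\<close>

lemma energy_bound:
  assumes pq: "0 \<le> p" "p < q" "q \<le> L" and nz: "\<And>x. p < x \<Longrightarrow> x < q \<Longrightarrow> u x \<noteq> 0"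
    and d: "d = p \<and> w p = 0 \<and> u q = 0 \<or> d = q \<and> u p = 0 \<and> w q = 0"
  shows "energy_diff p q u lam / (u d)\<^sup>2 \<le> L1_dist_on p q a lam"
proof -
  have pq': "p \<le> q" using pq by simp
  have uc: "continuous_on {p..q} u" and wc: "continuous_on {p..q} w"
    using pq by (auto intro: continuous_on_subset[OF u_cont] continuous_on_subset[OF w_cont])
  have ai: "a absolutely_integrable_on {p..q}"
    by (rule absolutely_integrable_on_Icc_subset[OF a_int pq(1,3)])
  have uD: "(u has_real_derivative w x) (at x within {p..q})" if "x \<in> {p..q}" for x
    using that pq by (intro DERIV_subset[OF u_deriv]) auto
  have deriv_u: "deriv u x = w x" if "x \<in> {p<..<q}" for x
    using u_deriv[of x] that pq by (intro DERIV_imp_deriv) (simp add: at_within_Icc_at)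
  have "(LINT t|lebesgue_on {p<..<q}. (deriv u t)\<^sup>2) = (LINT t|lebesgue_on {p<..<q}. (w t)\<^sup>2)"
    using deriv_u by (intro Bochner_Integration.integral_cong) auto
  also have "\<dots> = integral {p..q} (\<lambda>t. (w t)\<^sup>2)"
    by (intro integral_lebesgue_on_Ioo absolutely_integrable_continuous_real continuous_intros wc)
  also have "\<dots> = integral {p..q} (\<lambda>x. w x * w x)"
    by (simp add: power2_eq_square)
  \<comment> \<open>Both boundary terms \<open>u w\<close> vanish: each end is a zero of one of the
    factors.\<close>
  also have "\<dots> = integral {p..q} (\<lambda>x. a x * u x * u x)"
    using w_by_parts[OF pq(1) pq' pq(3) uD wc] d by auto
  finally have kinetic: "(LINT t|lebesgue_on {p<..<q}. (deriv u t)\<^sup>2) = integral {p..q} (\<lambda>x. a x * (u x)\<^sup>2)"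
    by (simp add: power2_eq_square mult.assoc)
  have u2c: "continuous_on {p..q} (\<lambda>x. (u x)\<^sup>2)"
    by (intro continuous_intros uc)
  have "lam * (LINT t|lebesgue_on {p<..<q}. (u t)\<^sup>2) = lam * integral {p..q} (\<lambda>t. (u t)\<^sup>2)"
    by (subst integral_lebesgue_on_Ioo) (auto intro: absolutely_integrable_continuous_real u2c)
  also have "\<dots> = integral {p..q} (\<lambda>t. lam * (u t)\<^sup>2)" by simp
  finally have potential: "lam * (LINT t|lebesgue_on {p<..<q}. (u t)\<^sup>2) = integral {p..q} (\<lambda>t. lam * (u t)\<^sup>2)" .
  have i1: "(\<lambda>x. a x * (u x)\<^sup>2) integrable_on {p..q}"
    by (rule set_lebesgue_integral_eq_integral(1)[OF absolutely_integrable_mult_continuous[OF ai u2c]])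
  have i2: "(\<lambda>x. lam * (u x)\<^sup>2) integrable_on {p..q}"
    by (intro integrable_continuous_real continuous_intros uc)
  have E: "energy_diff p q u lam = integral {p..q} (\<lambda>x. (a x - lam) * (u x)\<^sup>2)"
    unfolding energy_diff_def kinetic potential
    using Henstock_Kurzweil_Integration.integral_diff[OF i1 i2] by (simp add: left_diff_distrib)
  have dabs: "(\<lambda>x. \<bar>a x - lam\<bar>) absolutely_integrable_on {p..q}"
    by (rule set_integrable_abs[OF set_integral_diff(1)[OF ai absolutely_integrable_on_const]]) simp
  have N: "L1_dist_on p q a lam = integral {p..q} (\<lambda>x. \<bar>a x - lam\<bar>)"
    unfolding L1_dist_on_def by (rule integral_lebesgue_on_Ioo[OF dabs])
  have "u d \<noteq> 0"
    using d no_double_zero[of d] pq by auto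
  obtain \<sigma> where "(\<sigma> = 1 \<or> \<sigma> = - 1) \<and> (\<forall>x. p < x \<longrightarrow> x < q \<longrightarrow> \<sigma> * u x > 0)"
    using sign_between_zeros[OF pq nz] by blast
  then have \<sigma>: "\<sigma> = 1 \<or> \<sigma> = - 1" "p < x \<Longrightarrow> x < q \<Longrightarrow> \<sigma> * u x > 0" for x
    by blast+
  have w_mono: "\<sigma> * w y \<le> \<sigma> * w x" if "p \<le> x" "x \<le> y" "y \<le> q" for x y
    using w_decreasing[OF pq(1,3) \<sigma>(2), of x y] that by (cases "x = y") auto
  have u_le: "\<sigma> * u x \<le> \<sigma> * u d" if x: "p \<le> x" "x \<le> q" for x
    using d
  proof
    assume e: "d = p \<and> w p = 0 \<and> u q = 0"
    have "\<sigma> * u x - \<sigma> * u d = \<sigma> * integral {p..x} w"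
      using u_diff[of p x] e x pq by (simp flip: right_diff_distrib)
    also have "\<dots> = integral {p..x} (\<lambda>t. \<sigma> * w t)" by simp
    also have "\<dots> \<le> integral {p..x} (\<lambda>t. 0)"
      using x w_mono[of p] e
      by (intro integral_le integrable_continuous_real continuous_intros continuous_on_subset[OF wc]) auto
    finally show ?thesis by simp
  next
    assume e: "d = q \<and> u p = 0 \<and> w q = 0"
    have "integral {x..q} (\<lambda>t. 0) \<le> integral {x..q} (\<lambda>t. \<sigma> * w t)"
      using x w_mono[of _ q] e
      by (intro integral_le integrable_continuous_real continuous_intros continuous_on_subset[OF wc]) auto
    also have "\<dots> = \<sigma> * integral {x..q} w" by simp
    also have "\<dots> = \<sigma> * u d - \<sigma> * u x"
      using u_diff[of x q] e x pq by (simp flip: right_diff_distrib)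
    finally show ?thesis by simp
  qed
  have u2_le: "(u x)\<^sup>2 \<le> (u d)\<^sup>2" if x: "p < x" "x < q" for x
  proof -
    have "(\<sigma> * u x)\<^sup>2 \<le> (\<sigma> * u d)\<^sup>2"
      using u_le[of x] \<sigma>(2)[of x] x by (intro power_mono) auto
    then show ?thesis
      using \<sigma>(1) by (auto simp: power_mult_distrib)
  qed
  have "energy_diff p q u lam \<le> integral {p..q} (\<lambda>x. \<bar>a x - lam\<bar> * (u d)\<^sup>2)"
    unfolding E
  proof (rule integral_le_ae)
    show "(\<lambda>x. (a x - lam) * (u x)\<^sup>2) integrable_on {p..q}"
      using integrable_diff[OF i1 i2] by (simp add: left_diff_distrib)
    show "(\<lambda>x. \<bar>a x - lam\<bar> * (u d)\<^sup>2) integrable_on {p..q}"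
      by (intro integrable_on_mult_left set_lebesgue_integral_eq_integral(1)[OF dabs])
    show "negligible {p, q}" by auto
    show "(a x - lam) * (u x)\<^sup>2 \<le> \<bar>a x - lam\<bar> * (u d)\<^sup>2" if "x \<in> {p..q} - {p, q}" for x
      using that by (intro mult_mono u2_le) auto
  qed
  also have "\<dots> = L1_dist_on p q a lam * (u d)\<^sup>2"
    by (simp add: N)
  finally show ?thesis
    using \<open>u d \<noteq> 0\<close> by (simp add: divide_le_eq)
qed

lemma zeros_enum_gaps:
  assumes en: "zeros_enum L u m x" and i: "i < 2 * m"
  shows "0 \<le> x i" "x i < x (i + 1)" "x (i + 1) \<le> L"
    and "\<And>t. x i < t \<Longrightarrow> t < x (i + 1) \<Longrightarrow> u t \<noteq> 0"
    and "even i \<Longrightarrow> w (x i) = 0 \<and> u (x (i + 1)) = 0"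
    and "odd i \<Longrightarrow> u (x i) = 0 \<and> w (x (i + 1)) = 0"
proof -
  have mono: "x j < x j'" if "j < j'" "j' \<le> 2 * m" for j j'
    using en that unfolding zeros_enum_def strict_mono_on_def by simp
  have mono_le: "x j \<le> x j'" if "j \<le> j'" "j' \<le> 2 * m" for j j'
    using mono[of j j'] that by (cases "j = j'") auto
  have x0: "x 0 = 0" "x (2 * m) = L"
    using en by (auto simp: zeros_enum_def)
  have W: "w (x (2 * k)) = 0" if "k \<le> m" for k
    using en that deriv_zeros_eq unfolding zeros_enum_def by blast
  have U: "inner_zeros L u = {x (2 * k + 1) |k. k < m}"
    using en by (simp add: zeros_enum_def)
  have U0: "u (x (2 * k + 1)) = 0" if "k < m" for k
    using U that by (auto simp: inner_zeros_def)
  show x: "0 \<le> x i" "x i < x (i + 1)" "x (i + 1) \<le> L"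
    using mono_le[of 0 i] mono[of i "i + 1"] mono_le[of "i + 1" "2 * m"] i x0 by auto
  show "u t \<noteq> 0" if t: "x i < t" "t < x (i + 1)" for t
  proof
    assume "u t = 0"
    then have "t \<in> inner_zeros L u"
      using t x by (simp add: inner_zeros_def)
    then obtain k where k: "k < m" "t = x (2 * k + 1)"
      unfolding U by blast
    then have "i < 2 * k + 1" "2 * k + 1 < i + 1"
      using mono_le[of "2 * k + 1" i] mono_le[of "i + 1" "2 * k + 1"] t i by (auto simp: not_less[symmetric])
    then show False by simp
  qed
  show "w (x i) = 0 \<and> u (x (i + 1)) = 0" if e: "even i"
  proof -
    obtain k where "i = 2 * k" using e by (elim evenE)
    then show ?thesis using W[of k] U0[of k] i by simp
  qed
  show "u (x i) = 0 \<and> w (x (i + 1)) = 0" if o: "odd i"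
  proof -
    obtain k where "i = 2 * k + 1" using o by (elim oddE)
    then show ?thesis using W[of "Suc k"] U0[of k] i by simp
  qed
qed

lemma zeros_enum_properties:
  assumes en: "zeros_enum L u m x" and n: "n \<ge> 1" and lam: "lam = eigval L n"
  shows "\<forall>i<2 * m. x (i + 1) - x i \<le> L / (2 * real n)"
    and "\<exists>i<2 * m. x (i + 1) - x i < L / (2 * real n)"
    and "m \<ge> n + 1"
proof -
  \<comment> \<open>For this \<open>k\<close> the quarter period \<open>pi / (2 * k)\<close> of the
    cosine equals \<open>L / (2 * n)\<close>.\<close>
  define k where "k = real n * pi / L"
  have k: "k > 0" "k\<^sup>2 = lam" "pi / (2 * k) = L / (2 * real n)"
    using n L_pos by (auto simp: k_def lam eigval_def power_mult_distrib power_divide)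
  note z = zeros_enum_gaps[OF en]
  have ends: "w (x i) = 0 \<and> u (x (i + 1)) = 0 \<or> u (x i) = 0 \<and> w (x (i + 1)) = 0" if "i < 2 * m" for i
    using z(5,6)[OF that] by blast
  have g: "x (i + 1) - x i = L / (2 * real n)" "negligible {t \<in> {x i..x (i + 1)}. \<not> a t = lam}"
    if i: "i < 2 * m" and long: "L / (2 * real n) \<le> x (i + 1) - x i" for i
    using gap[OF z(1-3)[OF i] z(4)[OF i] ends[OF i] k(1,2)] long unfolding k(3) by auto
  show le: "\<forall>i<2 * m. x (i + 1) - x i \<le> L / (2 * real n)"
    using g(1) by (metis linorder_le_cases order_refl)
  have x0: "x 0 = 0" "x (2 * m) = L"
    using en by (auto simp: zeros_enum_def)
  show strict: "\<exists>i<2 * m. x (i + 1) - x i < L / (2 * real n)"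
  proof (rule ccontr)
    assume none: "\<not> ?thesis"
    have neg: "negligible {t \<in> {x i..x (i + 1)}. \<not> a t = lam}" if "i < 2 * m" for i
      using g(2)[OF that] none that by (meson not_le)
    have "negligible (\<Union>i<2 * m. {t \<in> {x i..x (i + 1)}. \<not> a t = lam})"
      using neg by (intro negligible_Union) auto
    moreover have "{t \<in> {0..L}. lam < a t} \<subseteq> (\<Union>i<2 * m. {t \<in> {x i..x (i + 1)}. \<not> a t = lam})"
    proof clarify
      fix t assume t: "t \<in> {0..L}" "lam < a t"
      \<comment> \<open>The gaps up to any index \<open>j > 0\<close> cover everything from 0 to
        \<open>x j\<close>; the case \<open>j = 2 * m\<close> locates \<open>t\<close> in some
        gap.\<close>
      have "\<exists>i<j. t \<in> {x i..x (i + 1)}" if "0 < j" "j \<le> 2 * m" "t \<le> x j" for j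
        using that
      proof (induction j)
        case (Suc j)
        show ?case
        proof (cases "j > 0 \<and> t \<le> x j")
          case True
          then show ?thesis using Suc by (metis Suc_leD less_Suc_eq)
        next
          case False
          then have "x j \<le> t"
            using t x0 by (cases "j = 0") auto
          then show ?thesis using Suc.prems by auto
        qed
      qed simp
      moreover have "m > 0"
        using x0 L_pos by (cases m) auto
      ultimately obtain i where "i < 2 * m" "t \<in> {x i..x (i + 1)}"
        using x0 t(1) by (metis atLeastAtMost_iff mult_pos_pos order_refl zero_less_numeral)
      with t(2) show "t \<in> (\<Union>i<2 * m. {t \<in> {x i..x (i + 1)}. \<not> a t = lam})" by auto
    qed
    ultimately show False
      using a_gt negligible_subset by blast
  qed
  \<comment> \<open>The lengths telescope to \<open>L\<close>. The one strict gap is essential: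
    without it the sum would give only \<open>m \<ge> n\<close>.\<close>
  have "L = (\<Sum>i<2 * m. x (Suc i) - x i)"
    by (simp only: sum_lessThan_telescope x0 diff_zero)
  also have "\<dots> < (\<Sum>i<2 * m. L / (2 * real n))"
    using le strict by (intro sum_strict_mono_ex1) auto
  also have "\<dots> = L * (real m / real n)"
    by simp
  finally have "L * 1 < L * (real m / real n)" by simp
  then have "1 < real m / real n"
    using mult_less_cancel_left_pos[OF L_pos] by blast
  then show "m \<ge> n + 1"
    using n by (simp add: less_divide_eq)
qed

end

section \<open>From weak solutions to the final statement\<close>

lemma classical_neumann_if_Lambda_set:
  assumes L: "L > 0" and n: "n \<ge> 1" and a: "a \<in> Lambda_set L n" and u: "nontrivial_neumann_solution L a u"
  obtains w where "classical_neumann L (eigval L n) a u w"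
proof -
  have a1: "a \<in> L1_space L" and prec: "prec_ae L (\<lambda>_. eigval L n) a"
    using a by (auto simp: Lambda_set_def)
  have sol: "neumann_solution L a u" and nt: "\<exists>x\<in>{0..L}. u x \<noteq> 0"
    using u by (auto simp: nontrivial_neumann_solution_def)
  obtain w where w: "\<And>x. x \<in> {0..L} \<Longrightarrow> (u has_real_derivative w x) (at x within {0..L})"
    "\<And>x. x \<in> {0..L} \<Longrightarrow> w x = - integral {0..x} (\<lambda>t. a t * u t)" "w L = 0"
    by (rule neumann_solution_classical[OF L a1 sol]) blast
  have "classical_neumann L (eigval L n) a u w"
  proof
    show "eigval L n > 0"
      using L n by (simp add: eigval_def)
    show "a absolutely_integrable_on {0..L}"
      using a1 by (simp add: L1_space_def integrable_lebesgue_on_Ioo_iff)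
    show "negligible {x \<in> {0..L}. \<not> eigval L n \<le> a x}"
      using prec by (simp add: prec_ae_def AE_lebesgue_on_iff_negligible)
    show "\<not> negligible {x \<in> {0..L}. eigval L n < a x}"
      using prec by (auto simp: prec_ae_def negligible_iff_null_sets null_sets_def)
  qed (use L w nt in auto)
  then show thesis by (rule that)
qed

theorem lemma2p2:
  fixes L :: real and n :: nat
  assumes "L > 0" and "n \<ge> 1"
  shows
    "(\<forall>a u. a \<in> Lambda_set L n \<and> nontrivial_neumann_solution L a u \<longrightarrow>
        (\<exists>m x. zeros_enum L u m x)
        \<and> (\<forall>m x. zeros_enum L u m x \<longrightarrow>
             (\<forall>i<2 * m. x (i + 1) - x i \<le> L / (2 * real n))
             \<and> (\<exists>i<2 * m. x (i + 1) - x i < L / (2 * real n))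
             \<and> m \<ge> n + 1
             \<and> (\<forall>i<2 * m.
                  (odd i \<longrightarrow>
                     L1_dist_on (x i) (x (i + 1)) a (eigval L n)
                       \<ge> energy_diff (x i) (x (i + 1)) u (eigval L n) / (u (x (i + 1)))\<^sup>2)
                  \<and> (even i \<longrightarrow>
                     L1_dist_on (x i) (x (i + 1)) a (eigval L n)
                       \<ge> energy_diff (x i) (x (i + 1)) u (eigval L n) / (u (x i))\<^sup>2))))
     \<and> (\<forall>m\<ge>n + 1. \<exists>a u. a \<in> Lambda_set L n \<and> nontrivial_neumann_solution L a u
                        \<and> card (inner_zeros L u) = m)"
proof (rule conjI)
  show "\<forall>m\<ge>n + 1. \<exists>a u. a \<in> Lambda_set L n \<and> nontrivial_neumann_solution L a u
          \<and> card (inner_zeros L u) = m"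
  proof (intro allI impI exI conjI)
    fix m assume m: "m \<ge> n + 1"
    then have nm: "n < m" by simp
    show "(\<lambda>_. eigval L m) \<in> Lambda_set L n"
      "nontrivial_neumann_solution L (\<lambda>_. eigval L m) (\<lambda>x. cos (real m * pi / L * x))"
      by (rule eigval_in_Lambda_set[OF assms(1) nm])+
    show "card (inner_zeros L (\<lambda>x. cos (real m * pi / L * x))) = m"
      using m by (intro inner_zeros_cos[OF assms(1)]) simp
  qed
next
  show "\<forall>a u. a \<in> Lambda_set L n \<and> nontrivial_neumann_solution L a u \<longrightarrow>
        (\<exists>m x. zeros_enum L u m x)
        \<and> (\<forall>m x. zeros_enum L u m x \<longrightarrow>
             (\<forall>i<2 * m. x (i + 1) - x i \<le> L / (2 * real n))
             \<and> (\<exists>i<2 * m. x (i + 1) - x i < L / (2 * real n))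
             \<and> m \<ge> n + 1
             \<and> (\<forall>i<2 * m.
                  (odd i \<longrightarrow>
                     L1_dist_on (x i) (x (i + 1)) a (eigval L n)
                       \<ge> energy_diff (x i) (x (i + 1)) u (eigval L n) / (u (x (i + 1)))\<^sup>2)
                  \<and> (even i \<longrightarrow>
                     L1_dist_on (x i) (x (i + 1)) a (eigval L n)
                       \<ge> energy_diff (x i) (x (i + 1)) u (eigval L n) / (u (x i))\<^sup>2)))"
  proof (intro allI impI, elim conjE)
    fix a u assume "a \<in> Lambda_set L n" "nontrivial_neumann_solution L a u"
    then obtain w where "classical_neumann L (eigval L n) a u w"
      by (rule classical_neumann_if_Lambda_set[OF assms])
    then interpret classical_neumann L "eigval L n" a u w .
    show "(\<exists>m x. zeros_enum L u m x)
        \<and> (\<forall>m x. zeros_enum L u m x \<longrightarrow>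
             (\<forall>i<2 * m. x (i + 1) - x i \<le> L / (2 * real n))
             \<and> (\<exists>i<2 * m. x (i + 1) - x i < L / (2 * real n))
             \<and> m \<ge> n + 1
             \<and> (\<forall>i<2 * m.
                  (odd i \<longrightarrow>
                     L1_dist_on (x i) (x (i + 1)) a (eigval L n)
                       \<ge> energy_diff (x i) (x (i + 1)) u (eigval L n) / (u (x (i + 1)))\<^sup>2)
                  \<and> (even i \<longrightarrow>
                     L1_dist_on (x i) (x (i + 1)) a (eigval L n)
                       \<ge> energy_diff (x i) (x (i + 1)) u (eigval L n) / (u (x i))\<^sup>2)))"
    proof (intro conjI allI impI zeros_enum_exists)
      fix m x i
      assume en: "zeros_enum L u m x"
      note p = zeros_enum_properties[OF en assms(2) refl]
      show "x (i + 1) - x i \<le> L / (2 * real n)" if "i < 2 * m"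
        using p(1) that by blast
      show "\<exists>i<2 * m. x (i + 1) - x i < L / (2 * real n)" "m \<ge> n + 1"
        by (rule p)+
      assume i: "i < 2 * m"
      \<comment> \<open>Parity decides which end of the gap is critical: the right one for odd
        \<open>i\<close>, the left one for even \<open>i\<close>.\<close>
      note z = zeros_enum_gaps[OF en i]
      show "L1_dist_on (x i) (x (i + 1)) a (eigval L n)
          \<ge> energy_diff (x i) (x (i + 1)) u (eigval L n) / (u (x (i + 1)))\<^sup>2" if "odd i"
        using z(6)[OF that] by (intro energy_bound z(1-4)) auto
      show "L1_dist_on (x i) (x (i + 1)) a (eigval L n)
          \<ge> energy_diff (x i) (x (i + 1)) u (eigval L n) / (u (x i))\<^sup>2" if "even i"
        using z(5)[OF that] by (intro energy_bound z(1-4)) auto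
    qed
  qed
qed

end
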